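(* Suppose that $f(z)=h(z)+\overline{g(z)}=\sum_{n=0}^\infty a_nz^n+\overline{\sum_{n=1}^\infty b_nz^n}$ is a sense-preserving $K$-quasiconformal harmonic mapping in $\mathbb{D}$ and $h\prec\phi$, where $\phi\in\widehat{C_0}(\alpha)$ and $\alpha\in[1,2]$. Then $$\sum_{n=1}^\infty\left(|a_n|+|b_n|\right)r^n\le d(\phi(0),\partial\phi(\mathbb{D}))\quad\text{for } r\le r_0,$$ where $r_0\in(0,1/3)$ is the unique root of the equation $$\left(\frac{2K}{K+1}\right)\left(\left(\frac{1+r}{1-r}\right)^\alpha-1\right)-1=0.$$ The number $r_0$ is sharp.
   Context: $\mathbb{D}=\{z\in\mathbb{C}:|z|<1\}$, and $r=|z|\in[0,1)$. A harmonic mapping in $\mathbb{D}$ is written $f=h+\overline{g}$ with $h,g$ analytic in $\mathbb{D}$. It is locally univalent and sense-preserving if $h'\neq0$ in $\mathbb{D}$ and the dilatation $\omega=g'/h'$ satisfies $|\omega|<1$ in $\mathbb{D}$. Such an $f$ is called $K$-quasiconformal if $|\omega(z)|\le k<1$ for all $z\in\mathbb{D}$, where $K=(1+k)/(1-k)\ge1$, i.e. $k=(K-1)/(K+1)$. For analytic $h,\phi$ in $\mathbb{D}$, $h\prec\phi$ (subordination) means $h=\phi\circ w$ for some analytic $w$ on $\mathbb{D}$ with $|w|\le1$ in $\mathbb{D}$ and $w(0)=0$. $d(\phi(0),\partial\phi(\mathbb{D}))$ is the Euclidean distance from $\phi(0)$ to the boundary of $\phi(\mathbb{D})$. Sharp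 means that $r_0$ is the best possible. $\mathcal{A}$ is the class of analytic functions $\phi$ on $\mathbb{D}$ with $\phi(0)=\phi'(0)-1=0$. A domain $G$ is considered to have an opening angle $\pi\alpha$ at infinity if $G^c=\mathbb{C}\setminus G$ is included in a wedge-shaped region with an angle less than or equal to $\pi\alpha$ but not in a region with an angle larger than $\pi\alpha$. For $\alpha\in[1,2]$, $\widehat{C_0}(\alpha)$, the family of concave univalent functions with opening angle $\pi\alpha$ at infinity, is the class of functions $\phi:\mathbb{D}\to\mathbb{C}$ such that: (i) $\phi\in\mathcal{A}$ and $\phi(1)=\infty$; (ii) $\phi$ maps $\mathbb{D}$ conformally onto a set whose complement with respect to $\mathbb{C}$ is convex; (iii) the opening angle of $\phi(\mathbb{D})$ at infinity is less than or equal to $\pi\alpha$.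
   Formalization: For K=1, α=1 the root is exactly 1/3, so r_0 in (0,1/3] is proved, with r_0<1/3 in all other cases; the opening angle of G is read in the standard way as the least angle of a wedge containing G, the given wording being inconsistent. *)

theory Defs
  imports "HOL-Complex_Analysis.Complex_Analysis"
begin

abbreviation unit_disc :: "complex set" where
  "unit_disc \<equiv> ball 0 1"

definition dilatation :: "(complex \<Rightarrow> complex) \<Rightarrow> (complex \<Rightarrow> complex) \<Rightarrow> complex \<Rightarrow> complex" where
  "dilatation h g z = deriv g z / deriv h z"

definition sense_preserving_harmonic ::
    "(complex \<Rightarrow> complex) \<Rightarrow> (complex \<Rightarrow> complex) \<Rightarrow> (complex \<Rightarrow> complex) \<Rightarrow> bool" where
  "sense_preserving_harmonic f h g \<longleftrightarrow>
     h holomorphic_on unit_disc \<and> g holomorphic_on unit_disc \<and>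
     (\<forall>z\<in>unit_disc. f z = h z + cnj (g z)) \<and>
     (\<forall>z\<in>unit_disc. deriv h z \<noteq> 0 \<and> cmod (dilatation h g z) < 1)"

definition quasiconformal_harmonic ::
    "real \<Rightarrow> (complex \<Rightarrow> complex) \<Rightarrow> (complex \<Rightarrow> complex) \<Rightarrow> (complex \<Rightarrow> complex) \<Rightarrow> bool" where
  "quasiconformal_harmonic K f h g \<longleftrightarrow>
     sense_preserving_harmonic f h g \<and>
     (\<forall>z\<in>unit_disc. cmod (dilatation h g z) \<le> (K - 1) / (K + 1))"

text \<open>A Schwarz function here satisfies only \<open>|w| \<le> 1\<close>; together with \<open>w 0 = 0\<close> the maximum
  principle gives \<open>|w| < 1\<close>, so \<open>\<phi>\<close> is never evaluated outside the disc.\<close>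

definition subordinate :: "(complex \<Rightarrow> complex) \<Rightarrow> (complex \<Rightarrow> complex) \<Rightarrow> bool" where
  "subordinate h \<phi> \<longleftrightarrow>
     (\<exists>w. w holomorphic_on unit_disc \<and> w 0 = 0 \<and> (\<forall>z\<in>unit_disc. cmod (w z) \<le> 1) \<and>
          (\<forall>z\<in>unit_disc. h z = \<phi> (w z)))"

text \<open>The open wedge with vertex \<open>p\<close>, axis direction \<open>\<theta>\<close> and angle \<open>\<beta>\<close>; for \<open>\<beta> = 2\<pi>\<close> it is the
  plane slit along a ray.\<close>

definition wedge :: "complex \<Rightarrow> real \<Rightarrow> real \<Rightarrow> complex set" where
  "wedge p \<theta> \<beta> = {p + of_real \<rho> * cis t |\<rho> t. 0 < \<rho> \<and> \<bar>t - \<theta>\<bar> < \<beta> / 2}"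

text \<open>The opening angle is that of the domain \<open>G\<close> itself, not of its complement: a half-plane has
  opening angle \<open>\<pi>\<close> and a slit plane \<open>2\<pi>\<close>. It is the least angle of a wedge containing \<open>G\<close>;
  equivalently, \<open>2\<pi>\<close> minus the opening angle is the largest angle of a closed wedge (a ray, if that
  angle is 0) contained in \<open>- G\<close>.\<close>

definition has_opening_angle :: "complex set \<Rightarrow> real \<Rightarrow> bool" where
  "has_opening_angle G \<beta> \<longleftrightarrow>
     (\<exists>p \<theta>. G \<subseteq> wedge p \<theta> \<beta>) \<and> (\<forall>\<gamma><\<beta>. \<not> (\<exists>p \<theta>. G \<subseteq> wedge p \<theta> \<gamma>))"

definition normalized_class :: "(complex \<Rightarrow> complex) set" where
  "normalized_class = {\<phi>. \<phi> holomorphic_on unit_disc \<and> \<phi> 0 = 0 \<and> deriv \<phi> 0 = 1}"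

text \<open>The condition \<open>\<phi>(1) = \<infinity>\<close> is a limit taken within the disc.\<close>

definition concave_class :: "real \<Rightarrow> (complex \<Rightarrow> complex) set" where
  "concave_class \<alpha> =
     {\<phi>. \<phi> \<in> normalized_class \<and>
         filterlim \<phi> at_infinity (at 1 within unit_disc) \<and>
         inj_on \<phi> unit_disc \<and> convex (- (\<phi> ` unit_disc)) \<and>
         (\<exists>\<beta>\<le>pi * \<alpha>. has_opening_angle (\<phi> ` unit_disc) \<beta>)}"

definition radius_equation :: "real \<Rightarrow> real \<Rightarrow> real \<Rightarrow> bool" where
  "radius_equation K \<alpha> r \<longleftrightarrow>
     (2 * K / (K + 1)) * (((1 + r) / (1 - r)) powr \<alpha> - 1) - 1 = 0"

end

theory Submission
  imports Defs
begin

text \<open>Let \<open>G = \<phi>(unit_disc)\<close> and let \<open>c\<close> be any boundary point of \<open>G\<close>. The convex set \<open>- G\<close> contains a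
  cone of angle \<open>(2 - \<alpha>)\<pi>\<close>, whose directions are recession directions, so \<open>G\<close> lies in a wedge of angle
  \<open>\<pi>\<alpha>\<close> with vertex \<open>c\<close>. Hence \<open>h = c - c F(w)\<close> for a Schwarz function \<open>w\<close> and
  \<open>F(z) = ((1 + x z) / (1 - z))\<^sup>\<alpha>\<close> with \<open>|x| = 1\<close>; no coefficient bounds for concave functions are
  needed. By Bohr's theorem, for \<open>r \<le> 1/3\<close> the majorant series of \<open>h\<close> at \<open>r\<close> is at most \<open>|c|\<close> times that
  of \<open>F - 1\<close>, and that of \<open>g\<close> is at most \<open>k\<close> times that of \<open>h\<close>.

  It remains to see that \<open>x = 1\<close> is the worst case for \<open>F\<close>. Writing \<open>F' = \<alpha> (1 + x) exp E\<close>, the odd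
  coefficients of \<open>E\<close> are largest for \<open>x = 1\<close>; the even ones may be larger for other \<open>x\<close>, but as long as
  \<open>((1 + r) / (1 - r))\<^sup>\<alpha> \<le> 2\<close> the total excess is at most \<open>(1 - Y) / 2\<close> with \<open>Y = |1 + x|\<^sup>2 / 4\<close>, and
  the factor \<open>|1 + x| = 2 \<surd>Y \<le> 2 exp (- (1 - Y) / 2)\<close> makes up for it.\<close>

section \<open>Coefficient majorants\<close>

definition abs_psum :: "real \<Rightarrow> 'a::real_normed_field fps \<Rightarrow> nat \<Rightarrow> real" where
  "abs_psum r f N = (\<Sum>n<N. norm (fps_nth f n) * r ^ n)"

text \<open>For \<open>0 \<le> r\<close> this says that the majorant series converges with sum at
  most \<open>B\<close>. Phrased by partial sums, it lets products, compositions and antiderivatives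
  be treated with finite sums.\<close>

definition abs_bounded :: "real \<Rightarrow> 'a::real_normed_field fps \<Rightarrow> real \<Rightarrow> bool" where
  "abs_bounded r f B \<longleftrightarrow> (\<forall>N. abs_psum r f N \<le> B)"

lemma abs_psum_nonneg: "0 \<le> r \<Longrightarrow> 0 \<le> abs_psum r f N"
  unfolding abs_psum_def by (intro sum_nonneg) auto

lemma abs_bounded_nonneg: "abs_bounded r f B \<Longrightarrow> 0 \<le> B"
  unfolding abs_bounded_def by (auto simp: abs_psum_def dest: spec[of _ 0])

lemma abs_bounded_mono: "abs_bounded r f B \<Longrightarrow> B \<le> C \<Longrightarrow> abs_bounded r f C"
  unfolding abs_bounded_def by (auto intro: order_trans)

text \<open>The terms of the Cauchy product of degree below \<open>N\<close> fill the triangle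
  \<open>i + j < N\<close>, which lies in the square over which the product of the two partial sums
  runs.\<close>

lemma abs_psum_mult:
  assumes "0 \<le> r"
  shows "abs_psum r (f * g) N \<le> abs_psum r f N * abs_psum r g N"
proof -
  let ?t = "\<lambda>i j. (norm (fps_nth f i) * r ^ i) * (norm (fps_nth g j) * r ^ j)"
  have "abs_psum r (f * g) N \<le> (\<Sum>n<N. \<Sum>i\<le>n. ?t i (n - i))"
    unfolding abs_psum_def
  proof (intro sum_mono)
    fix n
    have "norm (fps_nth (f * g) n) \<le> (\<Sum>i\<le>n. norm (fps_nth f i) * norm (fps_nth g (n - i)))"
      unfolding fps_mult_nth atMost_atLeast0
      by (rule order_trans[OF norm_sum]) (simp add: norm_mult)
    then have "norm (fps_nth (f * g) n) * r ^ n
        \<le> (\<Sum>i\<le>n. norm (fps_nth f i) * norm (fps_nth g (n - i))) * r ^ n"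
      using assms by (intro mult_right_mono) auto
    also have "\<dots> = (\<Sum>i\<le>n. ?t i (n - i))"
      unfolding sum_distrib_right
      by (intro sum.cong refl) (simp add: power_add[symmetric] mult_ac)
    finally show "norm (fps_nth (f * g) n) * r ^ n \<le> (\<Sum>i\<le>n. ?t i (n - i))" .
  qed
  also have "\<dots> = (\<Sum>(i, j)\<in>{(i, j). i + j < N}. ?t i j)"
    by (rule sum.triangle_reindex[symmetric])
  also have "\<dots> \<le> (\<Sum>(i, j)\<in>{..<N} \<times> {..<N}. ?t i j)"
    using assms by (intro sum_mono2) auto
  also have "\<dots> = abs_psum r f N * abs_psum r g N"
    unfolding abs_psum_def sum_product sum.cartesian_product ..
  finally show ?thesis .
qed

lemma abs_bounded_mult:
  assumes "0 \<le> r" "abs_bounded r f A" "abs_bounded r g B"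
  shows "abs_bounded r (f * g) (A * B)"
  unfolding abs_bounded_def
proof
  fix N
  have "abs_psum r (f * g) N \<le> abs_psum r f N * abs_psum r g N"
    by (rule abs_psum_mult[OF assms(1)])
  also have "\<dots> \<le> A * B"
    using assms abs_bounded_nonneg[OF assms(2)]
    by (intro mult_mono) (auto simp: abs_bounded_def abs_psum_nonneg)
  finally show "abs_psum r (f * g) N \<le> A * B" .
qed

lemma abs_bounded_const: "0 \<le> r \<Longrightarrow> abs_bounded r (fps_const c) (norm c)"
  unfolding abs_bounded_def abs_psum_def
proof
  fix N :: nat
  assume "0 \<le> r"
  have "(\<Sum>n<N. norm (fps_nth (fps_const c) n) * r ^ n) = (\<Sum>n<N. if n = 0 then norm c else 0)"
    by (intro sum.cong) auto
  also have "\<dots> \<le> norm c" by (simp add: sum.delta)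
  finally show "(\<Sum>n<N. norm (fps_nth (fps_const c) n) * r ^ n) \<le> norm c" .
qed

lemma abs_bounded_fps_X: "0 \<le> r \<Longrightarrow> abs_bounded r (fps_X :: 'a::real_normed_field fps) r"
  unfolding abs_bounded_def abs_psum_def
proof
  fix N :: nat
  assume "0 \<le> r"
  then have "(\<Sum>n<N. norm (fps_nth (fps_X :: 'a fps) n) * r ^ n) \<le> (\<Sum>n<N. if n = 1 then r else 0)"
    by (intro sum_mono) (auto simp: fps_X_def)
  also have "\<dots> \<le> r" using \<open>0 \<le> r\<close> by (simp add: sum.delta)
  finally show "(\<Sum>n<N. norm (fps_nth (fps_X :: 'a fps) n) * r ^ n) \<le> r" .
qed

lemma abs_bounded_power:
  assumes "0 \<le> r" "abs_bounded r f A"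
  shows "abs_bounded r (f ^ n) (A ^ n)"
proof (induction n)
  case 0
  then show ?case using abs_bounded_const[OF assms(1), of "1::'a"] by simp
next
  case (Suc n)
  then show ?case using abs_bounded_mult[OF assms(1) assms(2)] by simp
qed

text \<open>By submultiplicativity \<open>w ^ i\<close> has majorant at most \<open>R ^ i\<close>,
  so substituting \<open>w\<close> at radius \<open>r\<close> costs no more than evaluating the
  majorant of \<open>f\<close> at \<open>R\<close>.\<close>

lemma abs_bounded_compose:
  assumes "0 \<le> r" "abs_bounded r w R" "abs_bounded R f B" "fps_nth w 0 = 0"
  shows "abs_bounded r (f oo w) B"
  unfolding abs_bounded_def
proof
  fix N
  have "abs_psum r (f oo w) N \<le> (\<Sum>n<N. \<Sum>i<N. norm (fps_nth f i) * (norm (fps_nth (w ^ i) n) * r ^ n))"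
    unfolding abs_psum_def
  proof (intro sum_mono)
    fix n assume "n \<in> {..<N}"
    have "norm (fps_nth (f oo w) n) * r ^ n
       \<le> (\<Sum>i=0..n. norm (fps_nth f i) * norm (fps_nth (w ^ i) n)) * r ^ n"
      unfolding fps_compose_nth using assms(1)
      by (intro mult_right_mono order_trans[OF norm_sum]) (simp_all add: norm_mult)
    also have "\<dots> = (\<Sum>i=0..n. norm (fps_nth f i) * (norm (fps_nth (w ^ i) n) * r ^ n))"
      unfolding sum_distrib_right by (simp add: mult_ac)
    \<comment> \<open>The enlarged range of \<open>i\<close> does not depend on \<open>n\<close>, so
      the two sums can be interchanged.\<close>
    also have "\<dots> \<le> (\<Sum>i<N. norm (fps_nth f i) * (norm (fps_nth (w ^ i) n) * r ^ n))"
      using \<open>n \<in> {..<N}\<close> assms(1) by (intro sum_mono2) auto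
    finally show "norm (fps_nth (f oo w) n) * r ^ n
       \<le> (\<Sum>i<N. norm (fps_nth f i) * (norm (fps_nth (w ^ i) n) * r ^ n))" .
  qed
  also have "\<dots> = (\<Sum>i<N. norm (fps_nth f i) * abs_psum r (w ^ i) N)"
    unfolding abs_psum_def sum_distrib_left by (rule sum.swap)
  also have "\<dots> \<le> (\<Sum>i<N. norm (fps_nth f i) * R ^ i)"
    using abs_bounded_power[OF assms(1,2)]
    by (intro sum_mono mult_left_mono) (auto simp: abs_bounded_def)
  also have "\<dots> \<le> B" using assms(3) by (simp add: abs_bounded_def abs_psum_def)
  finally show "abs_psum r (f oo w) N \<le> B" .
qed

lemma abs_bounded_exp:
  assumes "0 \<le> r"
  shows "abs_bounded r (fps_exp (1::complex)) (exp r)"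
  unfolding abs_bounded_def abs_psum_def
proof
  fix N
  have "(\<Sum>n<N. norm (fps_nth (fps_exp (1::complex)) n) * r ^ n) = (\<Sum>n<N. r ^ n /\<^sub>R fact n)"
    by (intro sum.cong refl) (simp add: norm_divide field_simps)
  also have "\<dots> \<le> exp r"
    using exp_converges[of r] assms by (intro sum_le_suminf[of "\<lambda>n. r ^ n /\<^sub>R fact n", THEN order_trans])
      (auto simp: sums_iff)
  finally show "(\<Sum>n<N. norm (fps_nth (fps_exp (1::complex)) n) * r ^ n) \<le> exp r" .
qed

section \<open>Comparing majorants by their derivatives in the radius\<close>

lemma DERIV_abs_psum:
  fixes f :: "complex fps"
  shows "((\<lambda>s. abs_psum s f (Suc N)) has_real_derivative abs_psum s (fps_deriv f) N) (at s)"
proof -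
  \<comment> \<open>Differentiation kills the constant term, which is therefore split off; a sum of
    length \<open>Suc N\<close> thus has a derivative of length \<open>N\<close>.\<close>
  have "((\<lambda>s. norm (fps_nth f 0) + (\<Sum>n<N. norm (fps_nth f (Suc n)) * s ^ Suc n)) has_real_derivative
      (\<Sum>n<N. norm (fps_nth f (Suc n)) * (real (Suc n) * s ^ n))) (at s)"
    by (rule derivative_eq_intros refl | simp add: mult_ac)+
  moreover have "(\<Sum>n<N. norm (fps_nth f (Suc n)) * (real (Suc n) * s ^ n)) = abs_psum s (fps_deriv f) N"
    unfolding abs_psum_def by (intro sum.cong refl) (simp add: norm_mult del: of_nat_Suc)
  ultimately show ?thesis
    unfolding abs_psum_def sum.lessThan_Suc_shift by simp
qed

lemma DERIV_dominated:
  fixes f g :: "real \<Rightarrow> real"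
  assumes "0 \<le> r"
    and "\<And>s. 0 \<le> s \<Longrightarrow> s \<le> r \<Longrightarrow> (f has_real_derivative f' s) (at s)"
    and "\<And>s. 0 \<le> s \<Longrightarrow> s \<le> r \<Longrightarrow> (g has_real_derivative g' s) (at s)"
    and "\<And>s. 0 \<le> s \<Longrightarrow> s \<le> r \<Longrightarrow> f' s \<le> g' s"
  shows "f r - f 0 \<le> g r - g 0"
proof -
  have "(\<lambda>s. g s - f s) 0 \<le> (\<lambda>s. g s - f s) r"
  proof (rule DERIV_nonneg_imp_nondecreasing[OF assms(1)])
    fix s assume "0 \<le> s" "s \<le> r"
    then show "\<exists>y. ((\<lambda>s. g s - f s) has_real_derivative y) (at s) \<and> 0 \<le> y"
      using assms(2-4)[of s] by (intro exI[of _ "g' s - f' s"]) (auto intro: DERIV_diff)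
  qed
  then show ?thesis by simp
qed

text \<open>In the radius, the majorant of \<open>f\<close> has the majorant of
  \<open>fps_deriv f\<close> as derivative; a bound \<open>T'\<close> on the latter along the
  segment from 0 to \<open>r\<close> integrates to the growth of \<open>T\<close>.\<close>

lemma abs_bounded_antideriv:
  fixes f :: "complex fps"
  assumes "0 \<le> r" "fps_nth f 0 = 0"
    and "\<And>s. 0 \<le> s \<Longrightarrow> s \<le> r \<Longrightarrow> (T has_real_derivative T' s) (at s)"
    and "\<And>s. 0 \<le> s \<Longrightarrow> s \<le> r \<Longrightarrow> abs_bounded s (fps_deriv f) (T' s)"
  shows "abs_bounded r f (T r - T 0)"
  unfolding abs_bounded_def
proof
  fix N
  have "abs_psum r f (Suc N) - abs_psum 0 f (Suc N) \<le> T r - T 0"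
    using assms DERIV_abs_psum[of f N]
    by (intro DERIV_dominated[of r _ "\<lambda>s. abs_psum s (fps_deriv f) N" _ T']) (auto simp: abs_bounded_def)
  moreover have "abs_psum 0 f (Suc N) = 0"
    using assms(2) unfolding abs_psum_def sum.lessThan_Suc_shift by simp
  moreover have "abs_psum r f N \<le> abs_psum r f (Suc N)"
    using assms(1) by (simp add: abs_psum_def)
  ultimately show "abs_psum r f N \<le> T r - T 0" by simp
qed

text \<open>Stated for equally long partial sums, so that no convergence of the right-hand side is needed.\<close>

lemma abs_psum_antideriv_mult:
  fixes f g w :: "complex fps"
  assumes "0 \<le> r" "fps_nth g 0 = 0" "fps_deriv g = w * fps_deriv f"
    and "\<And>s. 0 \<le> s \<Longrightarrow> s \<le> r \<Longrightarrow> abs_bounded s w k"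
  shows "abs_psum r g (Suc N) \<le> k * (abs_psum r f (Suc N) - norm (fps_nth f 0))"
proof -
  have "abs_psum r g (Suc N) - abs_psum 0 g (Suc N) \<le> k * abs_psum r f (Suc N) - k * abs_psum 0 f (Suc N)"
  proof (rule DERIV_dominated[OF assms(1)])
    fix s assume s: "0 \<le> s" "s \<le> r"
    show "((\<lambda>s. abs_psum s g (Suc N)) has_real_derivative abs_psum s (fps_deriv g) N) (at s)"
      by (rule DERIV_abs_psum)
    show "((\<lambda>s. k * abs_psum s f (Suc N)) has_real_derivative k * abs_psum s (fps_deriv f) N) (at s)"
      by (intro DERIV_cmult DERIV_abs_psum)
    have "abs_psum s (fps_deriv g) N \<le> abs_psum s w N * abs_psum s (fps_deriv f) N"
      unfolding assms(3) by (rule abs_psum_mult[OF s(1)])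
    also have "\<dots> \<le> k * abs_psum s (fps_deriv f) N"
      using assms(4)[OF s] s(1) by (intro mult_right_mono abs_psum_nonneg) (auto simp: abs_bounded_def)
    finally show "abs_psum s (fps_deriv g) N \<le> k * abs_psum s (fps_deriv f) N" .
  qed
  moreover have "abs_psum 0 h (Suc N) = norm (fps_nth h 0)" for h :: "complex fps"
    unfolding abs_psum_def sum.lessThan_Suc_shift by simp
  ultimately show ?thesis using assms(2) by (simp add: algebra_simps)
qed

section \<open>Bohr's theorem\<close>

lemma cis_times_eq: "cis (real n * t) = cis t ^ n"
  by (simp add: Complex.DeMoivre)

text \<open>Cauchy's formula for the \<open>n\<close>-th derivative on the circle of radius
  \<open>\<rho>\<close>, parametrised by the angle and multiplied by
  \<open>\<rho> ^ n / \<i>\<close>.\<close>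

lemma fourier_coefficient:
  assumes "f holomorphic_on unit_disc" "f has_fps_expansion F" "0 < \<rho>" "\<rho> < 1"
  shows "((\<lambda>t. f (of_real \<rho> * cis t) * cis (- (real n * t))) has_integral
           2 * of_real pi * fps_nth F n * of_real \<rho> ^ n) {0..2*pi}"
proof -
  have cont: "continuous_on (cball 0 \<rho>) f"
    using assms by (intro holomorphic_on_imp_continuous_on holomorphic_on_subset[OF assms(1)]) auto
  have hol: "f holomorphic_on ball 0 \<rho>"
    using assms by (intro holomorphic_on_subset[OF assms(1)]) auto
  have "((\<lambda>u. f u / (u - 0) ^ Suc n) has_contour_integral
          2 * pi * \<i> / fact n * (deriv ^^ n) f 0) (circlepath 0 \<rho>)"
    using Cauchy_has_contour_integral_higher_derivative_circlepath[OF cont hol, of 0 n] assms(3) by simp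
  then have "((\<lambda>t. f (0 + of_real \<rho> * cis t) / (of_real \<rho> * cis t) ^ Suc n * of_real \<rho> * \<i> * cis t)
      has_integral 2 * pi * \<i> / fact n * (deriv ^^ n) f 0) {0..2*pi}"
    unfolding circlepath_def by (subst (asm) has_contour_integral_part_circlepath_iff) (auto simp: mult_ac)
  then have "((\<lambda>t. of_real \<rho> ^ n / \<i> *
        (f (0 + of_real \<rho> * cis t) / (of_real \<rho> * cis t) ^ Suc n * of_real \<rho> * \<i> * cis t))
      has_integral of_real \<rho> ^ n / \<i> * (2 * pi * \<i> / fact n * (deriv ^^ n) f 0)) {0..2*pi}"
    by (rule has_integral_mult_right)
  moreover have "of_real \<rho> ^ n / \<i> *
        (f (0 + of_real \<rho> * cis t) / (of_real \<rho> * cis t) ^ Suc n * of_real \<rho> * \<i> * cis t)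
      = f (of_real \<rho> * cis t) * cis (- (real n * t))" for t
  proof -
    have "cis (- (real n * t)) = inverse (cis t ^ n)"
      by (simp add: cis_inverse[symmetric] cis_times_eq[symmetric] del: cis_inverse) 
    then show ?thesis using assms(3) by (simp add: field_simps power_mult_distrib)
  qed
  moreover have "of_real \<rho> ^ n / \<i> * (2 * pi * \<i> / fact n * (deriv ^^ n) f 0)
      = 2 * of_real pi * fps_nth F n * of_real \<rho> ^ n"
    using fps_nth_fps_expansion[OF assms(2), of n] by (simp add: field_simps)
  ultimately show ?thesis by simp
qed

text \<open>Up to a constant this is the integral of the holomorphic function
  \<open>f u * u ^ (n - 1)\<close> over a closed circle, so Cauchy's theorem applies.\<close>

lemma fourier_coefficient_negative:
  assumes "f holomorphic_on unit_disc" "0 < \<rho>" "\<rho> < 1" "0 < n"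
  shows "((\<lambda>t. f (of_real \<rho> * cis t) * cis (real n * t)) has_integral 0) {0..2*pi}"
proof -
  have "((\<lambda>u. f u * u ^ (n - 1)) has_contour_integral 0) (circlepath 0 \<rho>)"
    using assms by (intro Cauchy_theorem_convex_simple[of _ unit_disc] holomorphic_intros) auto
  then have "((\<lambda>t. f (0 + of_real \<rho> * cis t) * (of_real \<rho> * cis t) ^ (n - 1) * of_real \<rho> * \<i> * cis t)
      has_integral 0) {0..2*pi}"
    unfolding circlepath_def by (subst (asm) has_contour_integral_part_circlepath_iff) (auto simp: mult_ac)
  then have "((\<lambda>t. 1 / (\<i> * of_real \<rho> ^ n) *
       (f (0 + of_real \<rho> * cis t) * (of_real \<rho> * cis t) ^ (n - 1) * of_real \<rho> * \<i> * cis t))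
      has_integral 1 / (\<i> * of_real \<rho> ^ n) * 0) {0..2*pi}"
    by (rule has_integral_mult_right)
  moreover have "1 / (\<i> * of_real \<rho> ^ n) *
       (f (0 + of_real \<rho> * cis t) * (of_real \<rho> * cis t) ^ (n - 1) * of_real \<rho> * \<i> * cis t)
      = f (of_real \<rho> * cis t) * cis (real n * t)" for t
  proof -
    obtain m where "n = Suc m" using assms(4) by (cases n) auto
    then show ?thesis
      using assms(2) unfolding cis_times_eq by (simp add: power_mult_distrib field_simps)
  qed
  ultimately show ?thesis by simp
qed

text \<open>Adding the conjugate of the vanishing coefficient of index \<open>- n\<close> turns the
  integrand into \<open>2 * Re p\<close> times a unimodular factor. As \<open>Re p\<close> is
  nonnegative, the modulus is at most the integral of \<open>2 * Re p\<close>, which the value at 0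
  determines; then \<open>\<rho>\<close> tends to 1.\<close>

lemma Caratheodory_coefficient_bound:
  assumes "p holomorphic_on unit_disc" "p has_fps_expansion P" "\<And>z. z \<in> unit_disc \<Longrightarrow> 0 \<le> Re (p z)" "0 < n"
  shows "norm (fps_nth P n) \<le> 2 * Re (fps_nth P 0)"
proof -
  have *: "norm (fps_nth P n) * \<rho> ^ n \<le> 2 * Re (fps_nth P 0)" if \<rho>: "0 < \<rho>" "\<rho> < 1" for \<rho>
  proof -
    let ?p = "\<lambda>t. p (of_real \<rho> * cis t)"
    have "((\<lambda>t. cnj (?p t * cis (real n * t))) has_integral cnj 0) {0..2*pi}"
      using fourier_coefficient_negative[OF assms(1) \<rho> assms(4)]
      by (subst has_integral_cnj[symmetric]) (simp add: o_def)
    then have "((\<lambda>t. ?p t * cis (- (real n * t)) + cnj (?p t * cis (real n * t))) has_integral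
        2 * of_real pi * fps_nth P n * of_real \<rho> ^ n + cnj 0) {0..2*pi}"
      by (intro has_integral_add fourier_coefficient[OF assms(1,2) \<rho>])
    moreover have "?p t * cis (- (real n * t)) + cnj (?p t * cis (real n * t))
        = of_real (2 * Re (?p t)) * cis (- (real n * t))" for t
      unfolding complex_add_cnj[symmetric] by (simp add: cis_cnj algebra_simps)
    ultimately have I: "((\<lambda>t. of_real (2 * Re (?p t)) * cis (- (real n * t))) has_integral
        2 * of_real pi * fps_nth P n * of_real \<rho> ^ n) {0..2*pi}" by simp
    have "((\<lambda>t. ?p t) has_integral 2 * of_real pi * fps_nth P 0) {0..2*pi}"
      using fourier_coefficient[OF assms(1,2) \<rho>, of 0] by simp
    then have "((\<lambda>t. Re (?p t)) has_integral Re (2 * of_real pi * fps_nth P 0)) {0..2*pi}"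
      by (rule has_integral_Re)
    then have J: "((\<lambda>t. 2 * Re (?p t)) has_integral 2 * Re (2 * of_real pi * fps_nth P 0)) {0..2*pi}"
      by (rule has_integral_mult_right)
    have "norm (2 * of_real pi * fps_nth P n * of_real \<rho> ^ n) \<le> 2 * Re (2 * of_real pi * fps_nth P 0)"
    proof (rule integral_norm_bound_integral[OF has_integral_integrable[OF I] has_integral_integrable[OF J],
          unfolded integral_unique[OF I] integral_unique[OF J]])
      fix t
      have "of_real \<rho> * cis t \<in> unit_disc" using \<rho> by (simp add: norm_mult)
      then show "norm (of_real (2 * Re (?p t)) * cis (- (real n * t))) \<le> 2 * Re (?p t)"
        using assms(3) by (simp add: norm_mult)
    qed
    then show ?thesis using \<rho> by (simp add: norm_mult norm_power mult_ac)
  qed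
  have "((\<lambda>\<rho>. norm (fps_nth P n) * \<rho> ^ n) \<longlongrightarrow> norm (fps_nth P n) * 1 ^ n) (at_left (1::real))"
    by (intro tendsto_intros)
  moreover have "eventually (\<lambda>\<rho>. norm (fps_nth P n) * \<rho> ^ n \<le> 2 * Re (fps_nth P 0)) (at_left (1::real))"
    by (rule eventually_mono[OF eventually_at_left_real[of 0 1]]) (auto intro: *)
  ultimately show ?thesis
    using tendsto_upperbound by fastforce
qed

text \<open>Caratheodory's bound for \<open>B - e * f\<close>, where the rotation \<open>e\<close>
  makes \<open>e * f 0\<close> real and nonnegative.\<close>

lemma bounded_coefficient:
  assumes "f holomorphic_on unit_disc" "f has_fps_expansion F" "\<And>z. z \<in> unit_disc \<Longrightarrow> norm (f z) \<le> B" "0 < n"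
  shows "norm (fps_nth F n) \<le> 2 * (B - norm (fps_nth F 0))"
proof -
  obtain e where e: "norm e = 1" "e * fps_nth F 0 = of_real (norm (fps_nth F 0))"
  proof (cases "fps_nth F 0 = 0")
    case False
    then show ?thesis
      by (intro that[of "of_real (norm (fps_nth F 0)) / fps_nth F 0"]) (auto simp: norm_divide)
  qed (auto intro: that[of 1])
  have "norm (fps_nth (fps_const (of_real B) - fps_const e * F) n)
      \<le> 2 * Re (fps_nth (fps_const (of_real B) - fps_const e * F) 0)"
  proof (rule Caratheodory_coefficient_bound[of "\<lambda>z. of_real B - e * f z"])
    show "(\<lambda>z. of_real B - e * f z) has_fps_expansion fps_const (of_real B) - fps_const e * F"
      by (intro fps_expansion_intros assms)
    fix z :: complex assume "z \<in> unit_disc"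
    then show "0 \<le> Re (of_real B - e * f z)"
      using assms(3)[of z] complex_Re_le_cmod[of "e * f z"] e(1) by (simp add: norm_mult)
  qed (use assms in \<open>auto intro!: holomorphic_intros\<close>)
  then show ?thesis using e assms(4) by (simp add: norm_mult)
qed

text \<open>The terms of positive index are at most \<open>B - norm (fps_nth F 0)\<close> times
  \<open>2 * r ^ n\<close>, and the sum of \<open>2 * r ^ n\<close> over positive \<open>n\<close>
  reaches 1 exactly at \<open>r = 1/3\<close>.\<close>

lemma Bohr:
  assumes "f holomorphic_on unit_disc" "f has_fps_expansion F" "\<And>z. z \<in> unit_disc \<Longrightarrow> norm (f z) \<le> B"
    and "0 \<le> r" "r \<le> 1/3"
  shows "abs_bounded r F B"
  unfolding abs_bounded_def
proof
  fix N
  let ?a = "norm (fps_nth F 0)"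
  have aB: "?a \<le> B"
    using assms(3)[of 0] has_fps_expansion_imp_0_eq_fps_nth_0[OF assms(2)] by simp
  have "abs_psum r F N \<le> abs_psum r F (Suc N)"
    using assms(4) by (simp add: abs_psum_def)
  also have "\<dots> = ?a + (\<Sum>n<N. norm (fps_nth F (Suc n)) * r ^ Suc n)"
    unfolding abs_psum_def sum.lessThan_Suc_shift by simp
  also have "\<dots> \<le> ?a + (\<Sum>n<N. 2 * (B - ?a) * (1/3) ^ Suc n)"
    using assms(4,5) aB bounded_coefficient[OF assms(1-3)]
    by (intro add_left_mono sum_mono mult_mono power_mono) auto
  also have "\<dots> = ?a + (B - ?a) * (2/3 * (\<Sum>n<N. (1/3) ^ n))"
    by (simp add: sum_distrib_left algebra_simps diff_divide_distrib)
  also have "2/3 * (\<Sum>n<N. (1/3::real) ^ n) = 1 - (1/3) ^ N"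
    by (simp add: sum_gp_strict)
  also have "?a + (B - ?a) * (1 - (1/3) ^ N) \<le> B"
    using aB by (simp add: algebra_simps mult_right_mono)
  finally show "abs_psum r F N \<le> B" .
qed

text \<open>Bohr's theorem for \<open>w\<close> itself would only give 1. By the Schwarz lemma
  \<open>w z = z * v z\<close> with \<open>v\<close> bounded by 1, and Bohr's theorem for
  \<open>v\<close> leaves the factor \<open>r\<close>. Composition with \<open>w\<close> then does
  not enlarge the radius.\<close>

lemma Bohr_Schwarz:
  assumes "w holomorphic_on unit_disc" "w has_fps_expansion W" "w 0 = 0"
    and "\<And>z. z \<in> unit_disc \<Longrightarrow> norm (w z) < 1"
    and "0 \<le> r" "r \<le> 1/3"
  shows "abs_bounded r W r"
proof -
  obtain v where v: "v holomorphic_on unit_disc" "\<And>z. norm z < 1 \<Longrightarrow> w z = z * v z" "deriv w 0 = v 0"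
    using Schwarz3[OF assms(1,3)] by blast
  note S = Schwarz_Lemma[OF assms(1,3)]
  have "norm (v z) \<le> 1" if "z \<in> unit_disc" for z
  proof (cases "z = 0")
    case True
    then show ?thesis using S(2)[of 0] assms(4) v(3) by simp
  next
    case False
    then show ?thesis using S(1)[of z] assms(4) v(2)[of z] that by (simp add: norm_mult)
  qed
  moreover obtain V where V: "v has_fps_expansion V"
    using has_fps_expansion_fps_expansion[OF _ _ v(1)] by auto
  ultimately have "abs_bounded r V 1" using Bohr[OF v(1)] assms(5,6) by blast
  then have "abs_bounded r (fps_X * V) (r * 1)"
    by (intro abs_bounded_mult assms abs_bounded_fps_X)
  moreover have "W = fps_X * V"
  proof (rule fps_expansion_unique_complex[OF assms(2)])
    have "(\<lambda>z. z * v z) has_fps_expansion fps_X * V"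
      by (intro fps_expansion_intros V)
    moreover have "eventually (\<lambda>z. z * v z = w z) (nhds 0)"
      using v(2) by (intro eventually_mono[OF eventually_nhds_in_open[of unit_disc]]) auto
    ultimately show "w has_fps_expansion fps_X * V"
      using has_fps_expansion_cong[of "\<lambda>z. z * v z" w] by auto
  qed
  ultimately show ?thesis by simp
qed

section \<open>Conformal maps onto wedges\<close>

text \<open>The coefficient at 0 is 0, by \<open>x / 0 = 0\<close>.\<close>

definition log_fps :: "complex \<Rightarrow> complex fps" where
  "log_fps c = Abs_fps (\<lambda>n. c ^ n / of_nat n)"

lemma has_fps_expansion_log_fps:
  assumes "norm c \<le> 1"
  shows "(\<lambda>z. - Ln (1 - c * z)) has_fps_expansion log_fps c"
proof (rule has_fps_expansionI)
  have "(\<lambda>n. fps_nth (log_fps c) n * z ^ n) sums - Ln (1 - c * z)" if "z \<in> unit_disc" for z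
  proof -
    have "norm (c * z) \<le> 1 * norm z"
      unfolding norm_mult using assms by (intro mult_right_mono) auto
    then have "norm (- (c * z)) < 1" using that by simp
    from sums_minus[OF Ln_series'[OF this]] show ?thesis
      by (simp add: log_fps_def power_mult_distrib)
  qed
  then show "\<forall>\<^sub>F u in nhds 0. (\<lambda>n. fps_nth (log_fps c) n * u ^ n) sums - Ln (1 - c * u)"
    by (intro eventually_mono[OF eventually_nhds_in_open[of unit_disc]]) auto
qed

text \<open>For \<open>cmod x = 1\<close>, \<open>x \<noteq> -1\<close>, these are the conformal maps of the disc onto the wedges of
  angle \<open>\<pi>\<alpha>\<close> with vertex 0 that contain 1, normalised by \<open>0 \<mapsto> 1\<close>.\<close>

definition wedge_map :: "real \<Rightarrow> complex \<Rightarrow> complex \<Rightarrow> complex" where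
  "wedge_map \<alpha> x z = exp (of_real \<alpha> * (Ln (1 + x * z) - Ln (1 - z)))"

definition wedge_fps :: "real \<Rightarrow> complex \<Rightarrow> complex fps" where
  "wedge_fps \<alpha> x = fps_exp (of_real \<alpha>) oo (log_fps 1 - log_fps (- x))"

text \<open>The expansion of \<open>(\<alpha> - 1) Ln (1 + x z) - (\<alpha> + 1) Ln (1 - z)\<close>, the logarithm of
  \<open>wedge_map \<alpha> x' / (\<alpha> (1 + x))\<close>.\<close>

definition wedge_deriv_log_fps :: "real \<Rightarrow> complex \<Rightarrow> complex fps" where
  "wedge_deriv_log_fps \<alpha> x =
     fps_const (of_real (\<alpha> + 1)) * log_fps 1 - fps_const (of_real (\<alpha> - 1)) * log_fps (- x)"

lemma wedge_fps_nth_0 [simp]: "fps_nth (wedge_fps \<alpha> x) 0 = 1"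
  by (simp add: wedge_fps_def)

lemma has_fps_expansion_wedge_map:
  assumes "norm x = 1"
  shows "wedge_map \<alpha> x has_fps_expansion wedge_fps \<alpha> x"
proof -
  have "(\<lambda>z. - Ln (1 - 1 * z) - - Ln (1 - (- x) * z)) has_fps_expansion log_fps 1 - log_fps (- x)"
    using assms by (intro has_fps_expansion_diff has_fps_expansion_log_fps) auto
  then have "((\<lambda>z. exp (of_real \<alpha> * z)) \<circ> (\<lambda>z. - Ln (1 - 1 * z) - - Ln (1 - (- x) * z)))
      has_fps_expansion wedge_fps \<alpha> x"
    unfolding wedge_fps_def
    by (intro has_fps_expansion_compose has_fps_expansion_exp) (auto simp: log_fps_def)
  moreover have "((\<lambda>z. exp (of_real \<alpha> * z)) \<circ> (\<lambda>z. - Ln (1 - 1 * z) - - Ln (1 - (- x) * z))) = wedge_map \<alpha> x"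
    by (auto simp: wedge_map_def fun_eq_iff)
  ultimately show ?thesis by simp
qed

lemma Re_one_plus_pos: "norm x \<le> 1 \<Longrightarrow> norm z < 1 \<Longrightarrow> 0 < Re (1 + x * z)"
proof -
  assume "norm x \<le> 1" "norm z < 1"
  then have "norm (x * z) < 1"
    using mult_right_mono[of "norm x" 1 "norm z"] by (simp add: norm_mult)
  then show ?thesis using abs_Re_le_cmod[of "x * z"] by simp
qed

text \<open>Logarithmic differentiation produces \<open>(1 + x) / ((1 + x * z) * (1 - z))\<close>,
  whose denominator is absorbed into the exponent. The derivative becomes a constant times one
  exponential, so its majorant is controlled by that of the exponent.\<close>

lemma deriv_wedge_map:
  assumes "norm x \<le> 1" "norm z < 1"
  shows "(wedge_map \<alpha> x has_field_derivative of_real \<alpha> * (1 + x) *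
           exp (of_real (\<alpha> - 1) * Ln (1 + x * z) - of_real (\<alpha> + 1) * Ln (1 - z))) (at z)"
proof -
  have pos: "0 < Re (1 + x * z)" "0 < Re (1 - z)"
    using Re_one_plus_pos[OF assms] Re_one_plus_pos[of "-1" z] assms by auto
  then have np: "1 + x * z \<notin> \<real>\<^sub>\<le>\<^sub>0" "1 - z \<notin> \<real>\<^sub>\<le>\<^sub>0"
    unfolding complex_nonpos_Reals_iff by linarith+
  then have nz: "1 + x * z \<noteq> 0" "1 - z \<noteq> 0"
    by (metis nonpos_Reals_zero_I)+
  have "(wedge_map \<alpha> x has_field_derivative
      wedge_map \<alpha> x z * (of_real \<alpha> * (inverse (1 + x * z) * x + inverse (1 - z)))) (at z)"
    unfolding wedge_map_def using np nz by (auto intro!: derivative_eq_intros simp: divide_inverse mult_ac)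
  also have "inverse (1 + x * z) * x + inverse (1 - z) = (1 + x) * (inverse (1 + x * z) * inverse (1 - z))"
    using nz by (simp add: field_simps)
  also have "inverse (1 + x * z) = exp (- Ln (1 + x * z))"
    using nz by (simp add: exp_minus)
  also have "inverse (1 - z) = exp (- Ln (1 - z))"
    using nz by (simp add: exp_minus)
  also have "wedge_map \<alpha> x z * (of_real \<alpha> * ((1 + x) * (exp (- Ln (1 + x * z)) * exp (- Ln (1 - z)))))
     = of_real \<alpha> * (1 + x) * (wedge_map \<alpha> x z * exp (- Ln (1 + x * z)) * exp (- Ln (1 - z)))"
    by simp
  also have "wedge_map \<alpha> x z * exp (- Ln (1 + x * z)) * exp (- Ln (1 - z))
     = exp (of_real (\<alpha> - 1) * Ln (1 + x * z) - of_real (\<alpha> + 1) * Ln (1 - z))"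
    unfolding wedge_map_def exp_add[symmetric] by (simp add: algebra_simps)
  finally show ?thesis .
qed

lemma fps_deriv_wedge_fps:
  assumes "norm x = 1"
  shows "fps_deriv (wedge_fps \<alpha> x)
      = fps_const (of_real \<alpha> * (1 + x)) * (fps_exp 1 oo wedge_deriv_log_fps \<alpha> x)"
proof (rule fps_expansion_unique_complex)
  show "deriv (wedge_map \<alpha> x) has_fps_expansion fps_deriv (wedge_fps \<alpha> x)"
    by (intro has_fps_expansion_deriv has_fps_expansion_wedge_map assms)
  let ?E = "\<lambda>z. of_real (\<alpha> + 1) * (- Ln (1 - 1 * z)) - of_real (\<alpha> - 1) * (- Ln (1 - (- x) * z))"
  have "?E has_fps_expansion wedge_deriv_log_fps \<alpha> x"
    unfolding wedge_deriv_log_fps_def using assms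
    by (intro has_fps_expansion_diff has_fps_expansion_log_fps has_fps_expansion_cmult_left) auto
  then have "(exp \<circ> ?E) has_fps_expansion (fps_exp 1 oo wedge_deriv_log_fps \<alpha> x)"
    by (intro has_fps_expansion_compose has_fps_expansion_exp1)
      (auto simp: wedge_deriv_log_fps_def log_fps_def)
  then have "(\<lambda>z. of_real \<alpha> * (1 + x) * (exp \<circ> ?E) z) has_fps_expansion
      fps_const (of_real \<alpha> * (1 + x)) * (fps_exp 1 oo wedge_deriv_log_fps \<alpha> x)"
    by (rule has_fps_expansion_cmult_left)
  moreover have ev: "eventually (\<lambda>z. of_real \<alpha> * (1 + x) * (exp \<circ> ?E) z = deriv (wedge_map \<alpha> x) z) (nhds 0)"
  proof (rule eventually_mono[OF eventually_nhds_in_open[of unit_disc]])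
    fix z :: complex assume "z \<in> unit_disc"
    then have "deriv (wedge_map \<alpha> x) z = of_real \<alpha> * (1 + x) *
           exp (of_real (\<alpha> - 1) * Ln (1 + x * z) - of_real (\<alpha> + 1) * Ln (1 - z))"
      using assms by (intro DERIV_imp_deriv deriv_wedge_map) auto
    then show "of_real \<alpha> * (1 + x) * (exp \<circ> ?E) z = deriv (wedge_map \<alpha> x) z"
      by (simp add: algebra_simps)
  qed auto
  ultimately show "deriv (wedge_map \<alpha> x) has_fps_expansion
      fps_const (of_real \<alpha> * (1 + x)) * (fps_exp 1 oo wedge_deriv_log_fps \<alpha> x)"
    by (subst has_fps_expansion_cong[OF ev refl, symmetric])
qed

section \<open>Majorants of the wedge maps and of their derivatives\<close>

lemma norm_chord_le:
  fixes y :: complex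
  assumes "norm y = 1" "0 \<le> b"
  shows "norm (of_real (b + 2) - of_real b * y) \<le> 2 + b * (b + 2) / 4 * (norm (1 - y))\<^sup>2"
proof -
  have y: "(Re y)\<^sup>2 + (Im y)\<^sup>2 = 1" using assms(1) by (simp add: cmod_power2[symmetric])
  let ?c = "b * (b + 2) / 4 * (norm (1 - y))\<^sup>2"
  have c: "0 \<le> ?c" using assms(2) by simp
  \<comment> \<open>Since \<open>norm y = 1\<close>, the square is
    \<open>4 + 2 * b * (b + 2) * (1 - Re y)\<close>; completing the square then bounds the root of
    \<open>4 + 4 * ?c\<close> by \<open>2 + ?c\<close>.\<close>
  have "(norm (of_real (b + 2) - of_real b * y))\<^sup>2 = 4 + 4 * ?c"
    using y unfolding cmod_power2 by (simp add: power2_eq_square) algebra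
  also have "\<dots> \<le> (2 + ?c)\<^sup>2"
    using zero_le_power2[of ?c] by (simp add: power2_sum)
  finally show ?thesis by (rule power2_le_imp_le) (use c in simp)
qed

text \<open>The first summand is the coefficient for \<open>x = 1\<close>, the second the excess of the even ones.\<close>

lemma wedge_deriv_log_coefficient:
  assumes "norm x = 1" "1 \<le> \<alpha>"
  shows "norm (fps_nth (wedge_deriv_log_fps \<alpha> x) n) \<le> ((\<alpha> + 1) - (\<alpha> - 1) * (- 1) ^ n) / n
     + (\<alpha>\<^sup>2 - 1) * (1 - (norm (1 + x))\<^sup>2 / 4) / 2 * (real n + real n * (- 1) ^ n)"
proof (cases "n = 0")
  case True
  then show ?thesis by (simp add: wedge_deriv_log_fps_def log_fps_def)
next
  case n: False
  let ?Y = "(norm (1 + x))\<^sup>2 / 4"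
  \<comment> \<open>This puts the coefficient into the form of \<open>norm_chord_le\<close> with
    \<open>b = \<alpha> - 1\<close> and \<open>y = (- x) ^ n\<close>.\<close>
  have \<alpha>: "\<alpha> + 1 = (\<alpha> - 1) + 2" by simp
  have nth: "norm (fps_nth (wedge_deriv_log_fps \<alpha> x) n)
      = norm (of_real ((\<alpha> - 1) + 2) - of_real (\<alpha> - 1) * (- x) ^ n) / n"
    unfolding wedge_deriv_log_fps_def log_fps_def \<alpha>
    by (simp add: norm_divide diff_divide_distrib[symmetric] del: of_real_add of_real_diff)
  have x: "(Re x)\<^sup>2 + (Im x)\<^sup>2 = 1" using assms(1) by (simp add: cmod_power2[symmetric])
  \<comment> \<open>The parallelogram law for the unit vectors 1 and \<open>x\<close>.\<close>
  have Y1: "(norm (1 - x))\<^sup>2 = 4 * (1 - ?Y)"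
    using x unfolding cmod_power2 by (simp add: power2_eq_square) algebra
  have "0 \<le> 4 * (1 - ?Y)" unfolding Y1[symmetric] by simp
  then have Y: "0 \<le> 1 - ?Y" by simp
  show ?thesis
  proof (cases "even n")
    case False
    \<comment> \<open>For odd \<open>n\<close> the triangle inequality is an equality at
      \<open>x = 1\<close>, where \<open>(- x) ^ n = - 1\<close>.\<close>
    have "norm (of_real ((\<alpha> - 1) + 2) - of_real (\<alpha> - 1) * (- x) ^ n)
        \<le> norm (of_real ((\<alpha> - 1) + 2) :: complex) + norm (of_real (\<alpha> - 1) * (- x) ^ n)"
      by (rule norm_triangle_ineq4)
    also have "\<dots> = (\<alpha> + 1) + (\<alpha> - 1)"
      using assms by (simp add: norm_mult norm_power flip: of_real_add of_real_diff)
    finally show ?thesis unfolding nth using False n by (simp add: divide_right_mono)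
  next
    case True
    then obtain m where m: "n = 2 * m" by auto
    have "norm (1 - (- x) ^ n) = norm (1 ^ m - (x\<^sup>2) ^ m)"
      by (simp add: m power_mult)
    also have "\<dots> \<le> m * norm (1 - x\<^sup>2)"
      using assms(1) by (intro norm_power_diff) (auto simp: norm_power)
    finally have "(norm (1 - (- x) ^ n))\<^sup>2 \<le> (m * norm (1 - x\<^sup>2))\<^sup>2"
      by (intro power_mono) auto
    also have "1 - x\<^sup>2 = (1 - x) * (1 + x)" by (simp add: power2_eq_square algebra_simps)
    also have "(m * norm ((1 - x) * (1 + x)))\<^sup>2 = m\<^sup>2 * (16 * (1 - ?Y)) * ?Y"
      unfolding norm_mult power_mult_distrib Y1 by simp
    \<comment> \<open>Dropping the factor \<open>?Y\<close>, which is at most 1, leaves an excess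
      linear in \<open>1 - ?Y\<close>, ready to be compared with an exponential.\<close>
    also have "\<dots> \<le> m\<^sup>2 * (16 * (1 - ?Y)) * 1"
      using Y by (intro mult_left_mono) auto
    finally have *: "(norm (1 - (- x) ^ n))\<^sup>2 \<le> m\<^sup>2 * (16 * (1 - ?Y)) * 1" .
    have "norm (of_real ((\<alpha> - 1) + 2) - of_real (\<alpha> - 1) * (- x) ^ n)
        \<le> 2 + (\<alpha> - 1) * ((\<alpha> - 1) + 2) / 4 * (norm (1 - (- x) ^ n))\<^sup>2"
      using assms by (intro norm_chord_le) (auto simp: norm_power)
    also have "\<dots> \<le> 2 + (\<alpha> - 1) * ((\<alpha> - 1) + 2) / 4 * (m\<^sup>2 * (16 * (1 - ?Y)) * 1)"
      using assms(2) by (intro add_left_mono mult_left_mono *) auto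
    also have "\<dots> = 2 + (\<alpha>\<^sup>2 - 1) * (1 - ?Y) * n * n"
      unfolding m by (simp add: power2_eq_square field_simps)
    finally have "norm (of_real ((\<alpha> - 1) + 2) - of_real (\<alpha> - 1) * (- x) ^ n) / n
        \<le> (2 + (\<alpha>\<^sup>2 - 1) * (1 - ?Y) * n * n) / n"
      by (rule divide_right_mono) simp
    also have "\<dots> = 2 / n + (\<alpha>\<^sup>2 - 1) * (1 - ?Y) * n" using n by (simp add: add_divide_distrib)
    finally show ?thesis unfolding nth using True by (simp add: mult_ac)
  qed
qed

text \<open>The signs \<open>(- 1) ^ n\<close> turn the summed coefficient bounds into power series
  at \<open>s\<close> and \<open>- s\<close>: logarithms for the terms divided by \<open>n\<close>,
  and \<open>t / (1 - t)\<^sup>2\<close> for those multiplied by \<open>n\<close>.\<close>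

lemma wedge_deriv_log_bound:
  assumes "norm x = 1" "1 \<le> \<alpha>" "0 \<le> s" "s < 1"
  shows "abs_bounded s (wedge_deriv_log_fps \<alpha> x) ((\<alpha> - 1) * ln (1 + s) - (\<alpha> + 1) * ln (1 - s)
     + (\<alpha>\<^sup>2 - 1) * (1 - (norm (1 + x))\<^sup>2 / 4) / 2 * (2 * s / (1 - s\<^sup>2))\<^sup>2)"
proof -
  define c where "c = (\<alpha>\<^sup>2 - 1) * (1 - (norm (1 + x))\<^sup>2 / 4) / 2"
  let ?u = "\<lambda>n. (\<alpha> + 1) * (s ^ n / n) - (\<alpha> - 1) * ((- s) ^ n / n)
             + c * (n * s ^ n + n * (- s) ^ n)"
  \<comment> \<open>The term at \<open>n = 0\<close> is 0 by \<open>x / 0 = 0\<close>, so the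
    logarithm series may start there.\<close>
  have L: "(\<lambda>n. t ^ n / n) sums - ln (1 - t)" if "\<bar>t\<bar> < 1" for t :: real
    using sums_minus[OF ln_series'[of "- t"]] that by simp
  have G: "(\<lambda>n. n * t ^ n) sums (t / (1 - t)\<^sup>2)" if "\<bar>t\<bar> < 1" for t :: real
  proof -
    have "(\<lambda>n. t * (of_nat (Suc n) * t ^ n)) sums (t * (1 / (1 - t)\<^sup>2))"
      using that by (intro sums_mult geometric_deriv_sums) auto
    then show ?thesis
      by (subst sums_Suc_iff[symmetric, of "\<lambda>n. n * t ^ n", simplified]) (simp add: mult_ac)
  qed
  have "?u sums ((\<alpha> + 1) * - ln (1 - s) - (\<alpha> - 1) * - ln (1 - - s)
     + c * (s / (1 - s)\<^sup>2 + - s / (1 - - s)\<^sup>2))"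
    using assms by (intro sums_add sums_diff sums_mult L G) auto
  also have "s / (1 - s)\<^sup>2 + - s / (1 - - s)\<^sup>2 = (2 * s / (1 - s\<^sup>2))\<^sup>2"
  proof -
    have "1 - s \<noteq> 0" "1 + s \<noteq> 0" "1 - s\<^sup>2 = (1 - s) * (1 + s)"
      using assms by (auto simp: power2_eq_square algebra_simps)
    then show ?thesis by (simp add: divide_simps) (simp add: power2_eq_square algebra_simps)
  qed
  finally have U: "?u sums ((\<alpha> - 1) * ln (1 + s) - (\<alpha> + 1) * ln (1 - s)
     + c * (2 * s / (1 - s\<^sup>2))\<^sup>2)" by simp
  have le: "norm (fps_nth (wedge_deriv_log_fps \<alpha> x) n) * s ^ n \<le> ?u n" for n
  proof -
    have "norm (fps_nth (wedge_deriv_log_fps \<alpha> x) n) * s ^ n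
        \<le> (((\<alpha> + 1) - (\<alpha> - 1) * (- 1) ^ n) / n + c * (real n + real n * (- 1) ^ n)) * s ^ n"
      unfolding c_def by (rule mult_right_mono[OF wedge_deriv_log_coefficient[OF assms(1,2)]]) (use assms in simp)
    moreover have "(((\<alpha> + 1) - (\<alpha> - 1) * e) / n + c * (real n + real n * e)) * t
        = (\<alpha> + 1) * (t / n) - (\<alpha> - 1) * (e * t / n) + c * (n * t + n * (e * t))" for e t :: real
      by (simp add: ring_distribs diff_divide_distrib add_divide_distrib)
    ultimately show ?thesis unfolding power_minus[of s] by simp
  qed
  show ?thesis unfolding abs_bounded_def c_def[symmetric]
  proof
    fix N
    have "abs_psum s (wedge_deriv_log_fps \<alpha> x) N \<le> (\<Sum>n<N. ?u n)"
      unfolding abs_psum_def by (intro sum_mono le)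
    also have "\<dots> \<le> (\<Sum>n. ?u n)"
      using U assms(3) order_trans[OF _ le]
      by (intro sum_le_suminf) (auto simp: sums_iff)
    also have "\<dots> = (\<alpha> - 1) * ln (1 + s) - (\<alpha> + 1) * ln (1 - s) + c * (2 * s / (1 - s\<^sup>2))\<^sup>2"
      using U by (simp add: sums_iff)
    finally show "abs_psum s (wedge_deriv_log_fps \<alpha> x) N \<le> \<dots>" .
  qed
qed

text \<open>Bernoulli's inequality with \<open>m = 2 * s / (1 - s)\<close>: since
  \<open>1 + m = (1 + s) / (1 - s)\<close>, the hypothesis gives
  \<open>\<alpha> * m \<le> 1\<close>, and \<open>2 * s / (1 - s\<^sup>2)\<close> is at most
  \<open>m\<close>.\<close>

lemma powr_le_two_imp:
  fixes s \<alpha> :: real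
  assumes "1 \<le> \<alpha>" "0 \<le> s" "s < 1" "((1 + s) / (1 - s)) powr \<alpha> \<le> 2"
  shows "(\<alpha>\<^sup>2 - 1) * (2 * s / (1 - s\<^sup>2))\<^sup>2 \<le> 1"
proof -
  let ?m = "2 * s / (1 - s)"
  have m: "0 \<le> ?m" using assms by simp
  have "1 + \<alpha> * ?m \<le> (1 + ?m) powr \<alpha>"
  proof -
    have "(1 + \<alpha> * ?m) - (1 + \<alpha> * 0) \<le> (1 + ?m) powr \<alpha> - (1 + 0) powr \<alpha>"
    proof (rule DERIV_dominated[OF m])
      fix t :: real assume t: "0 \<le> t"
      show "((\<lambda>t. 1 + \<alpha> * t) has_real_derivative \<alpha>) (at t)"
        by (auto intro!: derivative_eq_intros)
      show "((\<lambda>t. (1 + t) powr \<alpha>) has_real_derivative \<alpha> * (1 + t) powr (\<alpha> - 1)) (at t)"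
        using t by (auto intro!: derivative_eq_intros)
      show "\<alpha> \<le> \<alpha> * (1 + t) powr (\<alpha> - 1)"
        using t assms(1) ge_one_powr_ge_zero[of "1 + t" "\<alpha> - 1"] by simp
    qed
    then show ?thesis by simp
  qed
  also have "1 + ?m = (1 + s) / (1 - s)" using assms by (simp add: field_simps)
  finally have "\<alpha> * ?m \<le> 1" using assms(4) by simp
  moreover have sq: "s\<^sup>2 \<le> s" "s\<^sup>2 < 1"
    using assms mult_left_mono[of s 1 s] by (auto simp: power2_eq_square)
  moreover have "0 \<le> 2 * s / (1 - s\<^sup>2)" "2 * s / (1 - s\<^sup>2) \<le> ?m"
    using assms sq by (auto intro!: divide_left_mono mult_pos_pos divide_nonneg_nonneg)
  ultimately have "\<alpha> * (2 * s / (1 - s\<^sup>2)) \<le> 1"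
    using assms(1) mult_left_mono[of "2 * s / (1 - s\<^sup>2)" ?m \<alpha>] by linarith
  then have "(\<alpha> * (2 * s / (1 - s\<^sup>2)))\<^sup>2 \<le> 1"
    using assms(1) \<open>0 \<le> 2 * s / (1 - s\<^sup>2)\<close> by (intro power_le_one mult_nonneg_nonneg) auto
  then have "\<alpha>\<^sup>2 * (2 * s / (1 - s\<^sup>2))\<^sup>2 \<le> 1"
    by (simp only: power_mult_distrib)
  moreover have "(\<alpha>\<^sup>2 - 1) * (2 * s / (1 - s\<^sup>2))\<^sup>2 \<le> \<alpha>\<^sup>2 * (2 * s / (1 - s\<^sup>2))\<^sup>2"
    by (intro mult_right_mono) auto
  ultimately show ?thesis by linarith
qed

text \<open>The bound is the derivative of \<open>((1 + s) / (1 - s)) powr \<alpha>\<close>, that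
  is, the value for \<open>x = 1\<close>.\<close>

lemma wedge_fps_deriv_bound:
  assumes "norm x = 1" "1 \<le> \<alpha>" "0 \<le> s" "s < 1" "((1 + s) / (1 - s)) powr \<alpha> \<le> 2"
  shows "abs_bounded s (fps_deriv (wedge_fps \<alpha> x))
           (2 * \<alpha> * exp ((\<alpha> - 1) * ln (1 + s) - (\<alpha> + 1) * ln (1 - s)))"
proof -
  let ?Y = "(norm (1 + x))\<^sup>2 / 4"
  let ?S = "(\<alpha> - 1) * ln (1 + s) - (\<alpha> + 1) * ln (1 - s)"
  have "norm (1 + x) \<le> 2" using norm_triangle_ineq[of 1 x] assms(1) by simp
  then have "(norm (1 + x))\<^sup>2 \<le> 2\<^sup>2" by (intro power_mono) auto
  then have Y: "0 \<le> 1 - ?Y" by simp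
  have "(\<alpha>\<^sup>2 - 1) * (1 - ?Y) / 2 * (2 * s / (1 - s\<^sup>2))\<^sup>2
      = (1 - ?Y) / 2 * ((\<alpha>\<^sup>2 - 1) * (2 * s / (1 - s\<^sup>2))\<^sup>2)" by simp
  also have "\<dots> \<le> (1 - ?Y) / 2 * 1"
    using Y by (intro mult_left_mono powr_le_two_imp assms) auto
  finally have B: "abs_bounded s (wedge_deriv_log_fps \<alpha> x) (?S + (1 - ?Y) / 2)"
    by (intro abs_bounded_mono[OF wedge_deriv_log_bound] assms) auto
  have "abs_bounded s (fps_exp 1 oo wedge_deriv_log_fps \<alpha> x) (exp (?S + (1 - ?Y) / 2))"
    by (rule abs_bounded_compose[OF assms(3) B abs_bounded_exp[OF abs_bounded_nonneg[OF B]]])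
      (simp add: wedge_deriv_log_fps_def log_fps_def)
  then have "abs_bounded s (fps_deriv (wedge_fps \<alpha> x))
      (norm (of_real \<alpha> * (1 + x)) * exp (?S + (1 - ?Y) / 2))"
    unfolding fps_deriv_wedge_fps[OF assms(1)]
    by (intro abs_bounded_mult abs_bounded_const assms(3))
  moreover have "norm (of_real \<alpha> * (1 + x)) * exp (?S + (1 - ?Y) / 2) \<le> 2 * \<alpha> * exp ?S"
  proof -
    \<comment> \<open>The left side is \<open>?Y\<close>, which is at most
      \<open>exp (?Y - 1)\<close>; taking roots offsets the excess \<open>(1 - ?Y) / 2\<close> in
      the exponent.\<close>
    have "(norm (1 + x) / 2)\<^sup>2 \<le> exp (?Y - 1)"
      using exp_ge_add_one_self[of "?Y - 1"] by (simp add: power_divide)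
    also have "\<dots> = (exp (- ((1 - ?Y) / 2)))\<^sup>2"
      by (simp add: power2_eq_square flip: exp_add)
    finally have "norm (1 + x) / 2 \<le> exp (- ((1 - ?Y) / 2))"
      by (rule power2_le_imp_le) simp
    then have "norm (1 + x) * exp ((1 - ?Y) / 2) \<le> 2"
      by (simp add: exp_minus field_simps)
    then have "\<alpha> * exp ?S * (norm (1 + x) * exp ((1 - ?Y) / 2)) \<le> \<alpha> * exp ?S * 2"
      using assms(2) by (intro mult_left_mono) auto
    then show ?thesis using assms(2) by (simp add: norm_mult exp_add mult_ac)
  qed
  ultimately show ?thesis by (rule abs_bounded_mono)
qed

text \<open>The derivative bound is integrated over the radius. The hypothesis at \<open>r\<close>
  passes to every smaller \<open>s\<close> because \<open>(1 + s) / (1 - s)\<close>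
  increases.\<close>

lemma wedge_fps_bound:
  assumes "norm x = 1" "1 \<le> \<alpha>" "0 \<le> r" "r < 1" "((1 + r) / (1 - r)) powr \<alpha> \<le> 2"
  shows "abs_bounded r (wedge_fps \<alpha> x - 1) (((1 + r) / (1 - r)) powr \<alpha> - 1)"
proof -
  let ?T = "\<lambda>s::real. exp (\<alpha> * (ln (1 + s) - ln (1 - s)))"
  have T: "?T s = ((1 + s) / (1 - s)) powr \<alpha>" if "0 \<le> s" "s < 1" for s
    using that by (simp add: powr_def ln_div mult_ac)
  have "abs_bounded r (wedge_fps \<alpha> x - 1) (?T r - ?T 0)"
  proof (rule abs_bounded_antideriv[OF assms(3)])
    show "fps_nth (wedge_fps \<alpha> x - 1) 0 = 0" by simp
    fix s assume s: "0 \<le> s" "s \<le> r"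
    have "(?T has_real_derivative ?T s * (\<alpha> * (1 / (1 + s) + 1 / (1 - s)))) (at s)"
      using s assms(4) by (auto intro!: derivative_eq_intros simp: field_simps)
    also have "1 / (1 + s) + 1 / (1 - s) = 2 * (exp (- ln (1 + s)) * exp (- ln (1 - s)))"
      using s assms(4) by (simp add: exp_minus field_simps)
    also have "?T s * (\<alpha> * (2 * (exp (- ln (1 + s)) * exp (- ln (1 - s)))))
        = 2 * \<alpha> * (?T s * exp (- ln (1 + s)) * exp (- ln (1 - s)))" by simp
    also have "?T s * exp (- ln (1 + s)) * exp (- ln (1 - s))
        = exp ((\<alpha> - 1) * ln (1 + s) - (\<alpha> + 1) * ln (1 - s))"
      unfolding exp_add[symmetric] by (simp add: algebra_simps)
    finally show "(?T has_real_derivative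
        2 * \<alpha> * exp ((\<alpha> - 1) * ln (1 + s) - (\<alpha> + 1) * ln (1 - s))) (at s)" .
    have "((1 + s) / (1 - s)) powr \<alpha> \<le> ((1 + r) / (1 - r)) powr \<alpha>"
      using s assms(2,4) by (intro powr_mono2 frac_le) auto
    then show "abs_bounded s (fps_deriv (wedge_fps \<alpha> x - 1))
        (2 * \<alpha> * exp ((\<alpha> - 1) * ln (1 + s) - (\<alpha> + 1) * ln (1 - s)))"
      using wedge_fps_deriv_bound[of x \<alpha> s] assms s by simp
  qed
  then show ?thesis using T[of r] assms by simp
qed

section \<open>Domains in wedges\<close>

lemma vertex_notin_wedge: "p \<notin> wedge p \<theta> \<beta>"
  by (auto simp: wedge_def)

lemma wedge_mono: "\<beta> \<le> \<gamma> \<Longrightarrow> wedge p \<theta> \<beta> \<subseteq> wedge p \<theta> \<gamma>"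
  unfolding wedge_def by fastforce

lemma of_real_cis_eq_imp:
  assumes "of_real \<rho> * cis s = of_real \<sigma> * cis t" "0 < \<rho>" "0 < \<sigma>"
  shows "\<rho> = \<sigma>" "cis s = cis t"
proof -
  have "norm (of_real \<rho> * cis s) = norm (of_real \<sigma> * cis t)" using assms(1) by simp
  then show *: "\<rho> = \<sigma>" using assms(2,3) by (simp add: norm_mult)
  show "cis s = cis t" using assms(1,2) unfolding * by simp
qed

lemma cis_eq_imp:
  assumes "cis s = cis t" "\<bar>s - t\<bar> < 2 * pi"
  shows "s = t"
proof -
  have "exp (\<i> * of_real s) = exp (\<i> * of_real t)" using assms(1) by (simp add: cis_conv_exp)
  then have "\<i> * of_real s = \<i> * of_real t"
    using exp_complex_eqI[of "\<i> * of_real s" "\<i> * of_real t"] assms(2) by simp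
  then show ?thesis by simp
qed

text \<open>Angles in \<open>wedge\<close> are not reduced modulo \<open>2 * pi\<close>; under these
  bounds two angles for the same point would be less than \<open>2 * pi\<close> apart, hence
  equal.\<close>

lemma notin_wedge_ray:
  assumes "\<gamma> \<le> 2 * pi" "\<bar>t - \<theta>\<bar> \<le> pi" "\<gamma> / 2 \<le> \<bar>t - \<theta>\<bar>" "0 < \<sigma>"
  shows "p + of_real \<sigma> * cis t \<notin> wedge p \<theta> \<gamma>"
proof
  assume "p + of_real \<sigma> * cis t \<in> wedge p \<theta> \<gamma>"
  then obtain \<rho> s where s: "of_real \<rho> * cis s = of_real \<sigma> * cis t" "0 < \<rho>" "\<bar>s - \<theta>\<bar> < \<gamma> / 2"
    by (auto simp: wedge_def)
  have "cis s = cis t" using of_real_cis_eq_imp[OF s(1,2) assms(4)] by simp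
  then have "s = t" 
    by (rule cis_eq_imp) (use assms(1,2) s(3) in linarith)
  then show False using s(3) assms(3) by simp
qed

text \<open>The complement of \<open>G\<close> is closed, convex and contains the cone complementary to the wedge, so
  the directions of this cone are recession directions at each of its points.\<close>

lemma subset_wedge_recenter:
  assumes "open G" "convex (- G)" "\<gamma> \<le> 2 * pi" "G \<subseteq> wedge p \<theta> \<gamma>" "c \<notin> G"
  shows "G \<subseteq> wedge c \<theta> \<gamma>"
proof
  fix y assume y: "y \<in> G"
  \<comment> \<open>\<open>t\<close> below is the argument of \<open>y - c\<close> that lies within
    \<open>pi\<close> of the axis direction, as \<open>notin_wedge_ray\<close> requires.\<close>
  define u where "u = (y - c) * cis (- \<theta>)"
  define t where "t = \<theta> + Arg u"
  define \<rho> where "\<rho> = norm (y - c)"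
  have "y \<noteq> c" using y assms(5) by auto
  then have \<rho>: "0 < \<rho>" by (simp add: \<rho>_def)
  have "u = of_real (norm u) * cis (Arg u)"
    using rcis_cmod_Arg[of u] by (simp add: rcis_def)
  from arg_cong[OF this, of "\<lambda>v. cis \<theta> * v"]
  have "cis \<theta> * u = cis \<theta> * (of_real (norm u) * cis (Arg u))" .
  also have "\<dots> = of_real (norm u) * cis t" by (simp add: t_def flip: cis_mult)
  also have "norm u = \<rho>" by (simp add: u_def \<rho>_def norm_mult)
  finally have "cis \<theta> * u = of_real \<rho> * cis t" .
  moreover have "cis \<theta> * u = (y - c) * (cis (- \<theta>) * cis \<theta>)"
    unfolding u_def by (simp only: mult_ac)
  moreover have "cis (- \<theta>) * cis \<theta> = 1" by (simp only: cis_mult) simp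
  ultimately have yt: "y = c + of_real \<rho> * cis t"
    by (simp only: mult_1_right) (simp add: algebra_simps)
  have t: "\<bar>t - \<theta>\<bar> \<le> pi" unfolding t_def using mpi_less_Arg[of u] Arg_le_pi[of u] by auto
  have "\<bar>t - \<theta>\<bar> < \<gamma> / 2"
  proof (rule ccontr)
    assume "\<not> \<bar>t - \<theta>\<bar> < \<gamma> / 2"
    then have ray: "p + of_real \<sigma> * cis t \<in> - G" if "0 < \<sigma>" for \<sigma>
      using notin_wedge_ray[OF assms(3) t _ that, of p] assms(4) by force
    \<comment> \<open>On the segment from \<open>c\<close> to the ray point at distance
      \<open>\<rho> * real (Suc n)\<close> from \<open>p\<close>, the point with parameter
      \<open>1 / real (Suc n)\<close> differs from \<open>y\<close> only by
      \<open>(p - c) / real (Suc n)\<close>. The limit puts \<open>y\<close> into the closed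
      complement.\<close>
    have mem: "y + of_real (inverse (real (Suc n))) * (p - c) \<in> - G" for n
    proof -
      define e where "e = inverse (real (Suc n))"
      define \<sigma> where "\<sigma> = \<rho> * real (Suc n)"
      have e: "0 \<le> e" "e \<le> 1" "0 < \<sigma>" "e * \<sigma> = \<rho>"
        unfolding e_def \<sigma>_def using \<rho> by (auto simp del: of_nat_Suc intro: mult_pos_pos) (simp add: field_simps)
      have mem: "(1 - e) *\<^sub>R c + e *\<^sub>R (p + of_real \<sigma> * cis t) \<in> - G"
        by (rule convexD_alt[OF assms(2) _ ray]) (use assms(5) e in auto)
      have "(1 - e) *\<^sub>R c + e *\<^sub>R (p + of_real \<sigma> * cis t)
          = c + of_real e * (p - c) + of_real (e * \<sigma>) * cis t"
        unfolding scaleR_conv_of_real of_real_diff of_real_mult of_real_1 by algebra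
      also have "\<dots> = y + of_real e * (p - c)"
        unfolding e(4) yt by (rule add.assoc[of c, THEN trans]) (simp only: add_ac)
      finally show ?thesis using mem unfolding e_def by simp
    qed
    have lim: "(\<lambda>n. y + of_real (inverse (real (Suc n))) * (p - c)) \<longlonglongrightarrow> y + of_real 0 * (p - c)"
      by (rule tendsto_add[OF tendsto_const
            tendsto_mult[OF tendsto_of_real[OF LIMSEQ_inverse_real_of_nat] tendsto_const]])
    have "closed (- G)" using assms(1) by (simp add: closed_def)
    then have "y + of_real 0 * (p - c) \<in> - G"
      by (rule closed_sequentially[OF _ _ lim]) (rule mem)
    then have "y \<in> - G" by simp
    then show False using y by simp
  qed
  then show "y \<in> wedge c \<theta> \<gamma>" unfolding wedge_def using yt \<rho> by blast
qed

text \<open>With the axis rotated to the positive reals, arguments lie strictly between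
  \<open>- pi\<close> and \<open>pi\<close> because \<open>\<alpha> \<le> 2\<close>. The principal
  logarithm is thus holomorphic on the wedge, and division by \<open>\<alpha>\<close> leads into a
  strip of width \<open>pi\<close>.\<close>

lemma wedge_Ln:
  assumes "1 \<le> \<alpha>" "\<alpha> \<le> 2" "v \<in> wedge c \<theta> (pi * \<alpha>)"
  shows "cis (- \<theta>) * (v - c) \<notin> \<real>\<^sub>\<le>\<^sub>0" "\<bar>Im (Ln (cis (- \<theta>) * (v - c)) / of_real \<alpha>)\<bar> < pi / 2"
proof -
  obtain \<rho> t where v: "v = c + of_real \<rho> * cis t" "0 < \<rho>" "\<bar>t - \<theta>\<bar> < pi * \<alpha> / 2"
    using assms(3) by (auto simp: wedge_def)
  have "pi * \<alpha> / 2 \<le> pi" using assms(2) by simp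
  then have t: "\<bar>t - \<theta>\<bar> < pi" using v(3) by linarith
  have eq: "cis (- \<theta>) * (v - c) = of_real \<rho> * cis (t - \<theta>)"
    unfolding v(1) by (simp add: cis_mult mult_ac)
  then have Arg: "Arg (cis (- \<theta>) * (v - c)) = t - \<theta>"
    using v(2) t by (intro Arg_unique'[of \<rho>]) (auto simp: rcis_def)
  have nz: "cis (- \<theta>) * (v - c) \<noteq> 0" unfolding eq using v(2) by simp
  show "cis (- \<theta>) * (v - c) \<notin> \<real>\<^sub>\<le>\<^sub>0"
  proof
    assume "cis (- \<theta>) * (v - c) \<in> \<real>\<^sub>\<le>\<^sub>0"
    then have "Re (cis (- \<theta>) * (v - c)) \<le> 0" "Im (cis (- \<theta>) * (v - c)) = 0"
      unfolding complex_nonpos_Reals_iff by blast+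
    moreover from this have "Re (cis (- \<theta>) * (v - c)) \<noteq> 0"
      using nz unfolding complex_eq_iff zero_complex.sel by blast
    ultimately have "Arg (cis (- \<theta>) * (v - c)) = pi"
      unfolding Arg_eq_pi by linarith
    then show False using Arg t by simp
  qed
  have Im: "Im (Ln (cis (- \<theta>) * (v - c)) / of_real \<alpha>) = (t - \<theta>) / \<alpha>"
    using Arg nz by (simp add: Arg_eq_Im_Ln)
  have "\<bar>t - \<theta>\<bar> / \<alpha> < pi / 2"
    using v(3) assms(1) by (simp add: field_simps)
  then show "\<bar>Im (Ln (cis (- \<theta>) * (v - c)) / of_real \<alpha>)\<bar> < pi / 2"
    unfolding Im using assms(1) by simp
qed

text \<open>An \<open>\<alpha>\<close>-th root about the vertex opens the wedge to the right
  half-plane, and a Moebius map sends the half-plane to the disc and \<open>P 0\<close> to 0. The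
  unimodular \<open>x\<close> records the argument of \<open>P 0\<close>.\<close>

lemma subordinate_to_wedge_map:
  assumes "h holomorphic_on unit_disc" "h 0 = 0" "1 \<le> \<alpha>" "\<alpha> \<le> 2"
    and "\<And>z. z \<in> unit_disc \<Longrightarrow> h z \<in> wedge c \<theta> (pi * \<alpha>)"
  obtains x w where "norm x = 1" "w holomorphic_on unit_disc" "w 0 = 0"
    "\<And>z. z \<in> unit_disc \<Longrightarrow> norm (w z) < 1"
    "\<And>z. z \<in> unit_disc \<Longrightarrow> h z = c - c * wedge_map \<alpha> x (w z)"
proof -
  define Q where "Q z = Ln (cis (- \<theta>) * (h z - c)) / of_real \<alpha>" for z
  define P where "P z = exp (Q z)" for z
  define x where "x = cnj (P 0) / P 0"
  define w where "w z = (P z - P 0) / (P z + cnj (P 0))" for z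
  note W = wedge_Ln[OF assms(3,4) assms(5)]
  have c: "c \<noteq> 0" using assms(5)[of 0] assms(2) vertex_notin_wedge by auto
  have holQ: "Q holomorphic_on unit_disc"
    unfolding Q_def using assms(1,3) W(1) by (auto intro!: holomorphic_intros)
  have ReP: "0 < Re (P z)" if "z \<in> unit_disc" for z
  proof -
    have "\<bar>Im (Q z)\<bar> < pi / 2" unfolding Q_def by (rule W(2)[OF that])
    then have "0 < cos (Im (Q z))" by (intro cos_gt_zero_pi) linarith+
    then show ?thesis by (simp add: P_def Re_exp)
  qed
  have ReP0: "0 < Re (P 0)" by (rule ReP) simp
  have P0: "P 0 \<noteq> 0" by (simp add: P_def)
  have den: "P z + cnj (P 0) \<noteq> 0" if "z \<in> unit_disc" for z
    using ReP[OF that] ReP0 by (auto simp: complex_eq_iff)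
  have x1: "norm x = 1" using P0 by (simp add: x_def norm_divide)
  have w1: "norm (w z) < 1" if "z \<in> unit_disc" for z
  proof -
    \<comment> \<open>Geometrically, \<open>P z\<close> is closer to \<open>P 0\<close> than to the
      mirror image \<open>- cnj (P 0)\<close> in the imaginary axis.\<close>
    have "(norm (P z + cnj (P 0)))\<^sup>2 = (norm (P z - P 0))\<^sup>2 + 4 * Re (P z) * Re (P 0)"
      unfolding cmod_power2 by (simp add: power2_eq_square algebra_simps)
    then have "(norm (P z - P 0))\<^sup>2 < (norm (P z + cnj (P 0)))\<^sup>2"
      using ReP[OF that] ReP0 by simp
    then have "norm (P z - P 0) < norm (P z + cnj (P 0))" by (rule power2_less_imp_less) simp
    then show ?thesis using den[OF that] by (simp add: w_def norm_divide)
  qed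
  show thesis
  proof (rule that[OF x1 _ _ w1])
    show "w holomorphic_on unit_disc"
      unfolding w_def using den holQ by (auto simp: P_def intro!: holomorphic_intros)
    show "w 0 = 0" by (simp add: w_def)
    fix z :: complex assume z: "z \<in> unit_disc"
    have pos: "0 < Re (1 + x * w z)" "0 < Re (1 - w z)"
      using Re_one_plus_pos[of x "w z"] Re_one_plus_pos[of "-1" "w z"] x1 w1[OF z] by auto
    then have nz: "1 + x * w z \<noteq> 0" "1 - w z \<noteq> 0"
      by (metis less_irrefl zero_complex.sel(1))+
    have "1 + x * w z = P z / P 0 * (1 - w z)"
      unfolding x_def w_def using den[OF z] P0 by (simp add: divide_simps) (simp add: algebra_simps)
    then have "P z / P 0 = (1 + x * w z) / (1 - w z)"
      using nz(2) by (simp add: nonzero_eq_divide_eq)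
    then have "exp (Ln (1 + x * w z) - Ln (1 - w z)) = exp (Q z - Q 0)"
      using nz by (simp add: exp_diff P_def)
    \<comment> \<open>All four imaginary parts are below \<open>pi / 2\<close>, so the two exponents
      differ by less than \<open>2 * pi\<close> in imaginary part and must agree.\<close>
    moreover have "\<bar>Im (Ln (1 + x * w z))\<bar> < pi / 2" "\<bar>Im (Ln (1 - w z))\<bar> < pi / 2"
      using pos nz Re_Ln_pos_lt by blast+
    moreover have "\<bar>Im (Q z)\<bar> < pi / 2" "\<bar>Im (Q 0)\<bar> < pi / 2"
      unfolding Q_def using W(2) z by auto
    ultimately have "Ln (1 + x * w z) - Ln (1 - w z) = Q z - Q 0"
      using exp_complex_eqI[of "Ln (1 + x * w z) - Ln (1 - w z)" "Q z - Q 0"] by simp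
    then have "wedge_map \<alpha> x (w z) = exp (of_real \<alpha> * Q z) / exp (of_real \<alpha> * Q 0)"
      by (simp add: wedge_map_def right_diff_distrib exp_diff)
    moreover have "exp (of_real \<alpha> * Q v) = cis (- \<theta>) * (h v - c)" if "v \<in> unit_disc" for v
    proof -
      have "cis (- \<theta>) * (h v - c) \<noteq> 0" using W(1)[OF that] by auto
      then show ?thesis using assms(3) by (simp add: Q_def)
    qed
    ultimately have "wedge_map \<alpha> x (w z) = (h z - c) / (- c)"
      using z assms(2) c by simp
    then show "h z = c - c * wedge_map \<alpha> x (w z)" using c by (simp add: field_simps)
  qed
qed

text \<open>Here \<open>h = - c * (F(w) - 1)\<close> with a wedge map \<open>F\<close>. The majorant
  of \<open>w\<close> at \<open>r\<close> is at most \<open>r\<close> by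
  \<open>Bohr_Schwarz\<close>, so that of \<open>F - 1\<close> is evaluated at \<open>r\<close>
  itself.\<close>

lemma wedge_valued_bound:
  assumes "h holomorphic_on unit_disc" "h has_fps_expansion H" "h 0 = 0" "1 \<le> \<alpha>" "\<alpha> \<le> 2"
    and "\<And>z. z \<in> unit_disc \<Longrightarrow> h z \<in> wedge c \<theta> (pi * \<alpha>)"
    and "0 \<le> r" "r \<le> 1/3" "((1 + r) / (1 - r)) powr \<alpha> \<le> 2"
  shows "abs_bounded r H (norm c * (((1 + r) / (1 - r)) powr \<alpha> - 1))"
proof -
  obtain x w where x: "norm x = 1" and w: "w holomorphic_on unit_disc" "w 0 = 0"
    "\<And>z. z \<in> unit_disc \<Longrightarrow> norm (w z) < 1"
    and h: "\<And>z. z \<in> unit_disc \<Longrightarrow> h z = c - c * wedge_map \<alpha> x (w z)"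
    using subordinate_to_wedge_map[OF assms(1,3,4,5,6)] by blast
  obtain W where W: "w has_fps_expansion W"
    using has_fps_expansion_fps_expansion[OF _ _ w(1)] by auto
  have W0: "fps_nth W 0 = 0"
    using has_fps_expansion_imp_0_eq_fps_nth_0[OF W] w(2) by simp
  have "((\<lambda>z. wedge_map \<alpha> x z - 1) \<circ> w) has_fps_expansion ((wedge_fps \<alpha> x - 1) oo W)"
    using W W0 x by (intro has_fps_expansion_compose has_fps_expansion_diff has_fps_expansion_wedge_map) auto
  then have "(\<lambda>z. - c * ((\<lambda>z. wedge_map \<alpha> x z - 1) \<circ> w) z) has_fps_expansion
      fps_const (- c) * ((wedge_fps \<alpha> x - 1) oo W)"
    by (rule has_fps_expansion_cmult_left)
  moreover have ev: "eventually (\<lambda>z. - c * ((\<lambda>z. wedge_map \<alpha> x z - 1) \<circ> w) z = h z) (nhds 0)"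
    using h by (intro eventually_mono[OF eventually_nhds_in_open[of unit_disc]]) (auto simp: algebra_simps)
  ultimately have "h has_fps_expansion fps_const (- c) * ((wedge_fps \<alpha> x - 1) oo W)"
    by (subst has_fps_expansion_cong[OF ev refl, symmetric])
  then have H: "H = fps_const (- c) * ((wedge_fps \<alpha> x - 1) oo W)"
    by (rule fps_expansion_unique_complex[OF assms(2)])
  have "abs_bounded r ((wedge_fps \<alpha> x - 1) oo W) (((1 + r) / (1 - r)) powr \<alpha> - 1)"
    using assms(4,7,8,9) x w W W0
    by (intro abs_bounded_compose[of _ _ r] Bohr_Schwarz[of w] wedge_fps_bound) auto
  then show ?thesis
    unfolding H using abs_bounded_mult[OF assms(7) abs_bounded_const[OF assms(7), of "- c"]] by simp
qed

section \<open>From wedge-valued functions to quasiconformal harmonic mappings\<close>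

lemma subordinate_imp_mem_image:
  assumes "subordinate h \<phi>" "z \<in> unit_disc"
  shows "h z \<in> \<phi> ` unit_disc"
proof -
  obtain w where w: "w holomorphic_on unit_disc" "w 0 = 0" "\<And>z. z \<in> unit_disc \<Longrightarrow> norm (w z) \<le> 1"
    and h: "\<And>z. z \<in> unit_disc \<Longrightarrow> h z = \<phi> (w z)"
    using assms(1) by (auto simp: subordinate_def)
  have "norm (w z) \<noteq> 1"
  proof
    assume *: "norm (w z) = 1"
    have "w constant_on unit_disc"
      using w(1,3) assms(2) * by (intro maximum_modulus_principle[of _ _ unit_disc z]) auto
    then have "w z = w 0" using assms(2) unfolding constant_on_def by auto
    then show False using * w(2) by simp
  qed
  then show ?thesis using w(3)[OF assms(2)] h[OF assms(2)] by auto
qed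

text \<open>Let \<open>k = (K - 1) / (K + 1)\<close>. Bohr's theorem bounds the majorant of the
  dilatation by \<open>k\<close>, so integrating \<open>deriv g = dilatation h g * deriv h\<close>
  shows that \<open>g\<close> adds at most \<open>k\<close> times the majorant of \<open>h\<close>;
  and \<open>1 + k = 2 * K / (K + 1)\<close>.\<close>

lemma quasiconformal_partial_sums:
  fixes a b :: "nat \<Rightarrow> complex"
  assumes "1 \<le> \<alpha>" "\<alpha> \<le> 2" "1 \<le> K"
    and "quasiconformal_harmonic K f h g"
    and "\<And>z. z \<in> unit_disc \<Longrightarrow> (\<lambda>n. a n * z ^ n) sums h z"
    and "\<And>z. z \<in> unit_disc \<Longrightarrow> (\<lambda>n. b (Suc n) * z ^ Suc n) sums g z"
    and "\<phi> \<in> concave_class \<alpha>" "subordinate h \<phi>" "c \<notin> \<phi> ` unit_disc"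
    and "0 \<le> r" "r \<le> 1/3" "((1 + r) / (1 - r)) powr \<alpha> \<le> 2"
  shows "(\<Sum>n<N. (cmod (a (Suc n)) + cmod (b (Suc n))) * r ^ Suc n)
           \<le> 2 * K / (K + 1) * (((1 + r) / (1 - r)) powr \<alpha> - 1) * norm c"
proof -
  define A where "A = Abs_fps a"
  \<comment> \<open>The series of \<open>g\<close> starts at index 1, so 0 takes the place of
    \<open>b 0\<close>.\<close>
  define B where "B = Abs_fps (\<lambda>n. if n = 0 then 0 else b n)"
  let ?k = "(K - 1) / (K + 1)"
  have \<phi>: "\<phi> holomorphic_on unit_disc" "\<phi> 0 = 0" "inj_on \<phi> unit_disc" "convex (- (\<phi> ` unit_disc))"
    using assms(7) by (auto simp: concave_class_def normalized_class_def)
  obtain \<beta> p \<theta> where \<beta>: "\<beta> \<le> pi * \<alpha>" "\<phi> ` unit_disc \<subseteq> wedge p \<theta> \<beta>"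
    using assms(7) by (auto simp: concave_class_def has_opening_angle_def)
  have "open (\<phi> ` unit_disc)" by (rule open_mapping_thm3[OF \<phi>(1) open_ball \<phi>(3)])
  \<comment> \<open>The wedge given by the opening angle is widened to angle
    \<open>pi * \<alpha>\<close> and then moved to the vertex \<open>c\<close>.\<close>
  then have sub: "\<phi> ` unit_disc \<subseteq> wedge c \<theta> (pi * \<alpha>)"
    using subset_wedge_recenter[OF _ \<phi>(4) _ order_trans[OF \<beta>(2) wedge_mono[OF \<beta>(1)]] assms(9)] assms(2)
    by simp
  have hol: "h holomorphic_on unit_disc" "g holomorphic_on unit_disc"
    and dh: "\<And>z. z \<in> unit_disc \<Longrightarrow> deriv h z \<noteq> 0"
    and dil: "\<And>z. z \<in> unit_disc \<Longrightarrow> norm (dilatation h g z) \<le> ?k"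
    using assms(4) by (auto simp: quasiconformal_harmonic_def sense_preserving_harmonic_def)
  have disc: "eventually (\<lambda>z. z \<in> unit_disc) (nhds (0::complex))"
    by (rule eventually_nhds_in_open) auto
  have A: "h has_fps_expansion A"
    by (intro has_fps_expansionI eventually_mono[OF disc]) (use assms(5) in \<open>simp add: A_def\<close>)
  have B: "g has_fps_expansion B"
  proof (intro has_fps_expansionI eventually_mono[OF disc])
    fix z :: complex assume "z \<in> unit_disc"
    then have "(\<lambda>n. fps_nth B (Suc n) * z ^ Suc n) sums g z"
      using assms(6) by (simp add: B_def)
    then show "(\<lambda>n. fps_nth B n * z ^ n) sums g z"
      by (subst (asm) sums_Suc_iff) (simp add: B_def)
  qed
  have h0: "h 0 = 0" using assms(8) \<phi>(2) by (auto simp: subordinate_def)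
  have A0: "fps_nth A 0 = 0" using has_fps_expansion_imp_0_eq_fps_nth_0[OF A] h0 by simp
  have "abs_bounded r A (norm c * (((1 + r) / (1 - r)) powr \<alpha> - 1))"
    using assms sub subordinate_imp_mem_image[OF assms(8)] h0
    by (intro wedge_valued_bound[OF hol(1) A]) auto
  then have Ab: "abs_psum r A (Suc N) \<le> norm c * (((1 + r) / (1 - r)) powr \<alpha> - 1)"
    by (simp add: abs_bounded_def)
  have hold: "dilatation h g holomorphic_on unit_disc"
    unfolding dilatation_def using hol dh by (intro holomorphic_intros holomorphic_deriv) auto
  then obtain D where D: "dilatation h g has_fps_expansion D"
    using has_fps_expansion_fps_expansion[OF _ _ hold] by auto
  have "fps_deriv B = D * fps_deriv A"
  proof (rule fps_expansion_unique_complex)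
    show "deriv g has_fps_expansion fps_deriv B"
      by (intro has_fps_expansion_deriv B)
    have ev: "eventually (\<lambda>z. dilatation h g z * deriv h z = deriv g z) (nhds 0)"
      by (rule eventually_mono[OF disc]) (use dh in \<open>auto simp: dilatation_def\<close>)
    have "(\<lambda>z. dilatation h g z * deriv h z) has_fps_expansion D * fps_deriv A"
      by (intro has_fps_expansion_mult has_fps_expansion_deriv A D)
    then show "deriv g has_fps_expansion D * fps_deriv A"
      by (subst has_fps_expansion_cong[OF ev refl, symmetric])
  qed
  then have Bb: "abs_psum r B (Suc N) \<le> ?k * (abs_psum r A (Suc N) - norm (fps_nth A 0))"
    using assms(10,11) dil
    by (intro abs_psum_antideriv_mult[where w = D] Bohr[OF hold D]) (auto simp: B_def)
  have "(\<Sum>n<N. (cmod (a (Suc n)) + cmod (b (Suc n))) * r ^ Suc n) = abs_psum r A (Suc N) + abs_psum r B (Suc N)"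
    unfolding abs_psum_def sum.lessThan_Suc_shift using A0
    by (simp add: A_def B_def sum.distrib distrib_right)
  also have "\<dots> \<le> (1 + ?k) * abs_psum r A (Suc N)"
    using Bb A0 by (simp add: algebra_simps)
  also have "\<dots> \<le> (1 + ?k) * (norm c * (((1 + r) / (1 - r)) powr \<alpha> - 1))"
    using Ab assms(3) by (intro mult_left_mono) auto
  also have "1 + ?k = 2 * K / (K + 1)" using assms(3) by (simp add: field_simps)
  finally show ?thesis by (simp add: mult_ac)
qed

section \<open>The extremal map\<close>

lemma wedge_cong:
  assumes "cis s = cis \<theta>"
  shows "wedge p \<theta> \<beta> \<subseteq> wedge p s \<beta>"
proof
  fix y assume "y \<in> wedge p \<theta> \<beta>"
  then obtain \<rho> t where y: "y = p + of_real \<rho> * cis t" "0 < \<rho>" "\<bar>t - \<theta>\<bar> < \<beta> / 2"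
    by (auto simp: wedge_def)
  have "cis (t + s - \<theta>) = cis t * cis s / cis \<theta>" by (simp add: cis_mult cis_divide)
  then have "cis (t + s - \<theta>) = cis t" using assms by simp
  then have "y = p + of_real \<rho> * cis (t + s - \<theta>)" using y(1) by simp
  moreover have "\<bar>t + s - \<theta> - s\<bar> < \<beta> / 2" using y(3) by simp
  ultimately show "y \<in> wedge p s \<beta>" unfolding wedge_def using y(2) by blast
qed

text \<open>The cosine decreases strictly on the interval from 0 to \<open>pi\<close>, which
  contains the half-angle. This form, free of arguments, gives access to convexity.\<close>

lemma mem_wedge_iff:
  assumes "1 \<le> \<alpha>" "\<alpha> \<le> 2"
  shows "y \<in> wedge p 0 (pi * \<alpha>) \<longleftrightarrow> cos (pi * \<alpha> / 2) * norm (y - p) < Re (y - p)"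
proof
  have d: "pi * \<alpha> / 2 \<le> pi" "0 \<le> pi * \<alpha> / 2" using assms by auto
  {
    assume "y \<in> wedge p 0 (pi * \<alpha>)"
    then obtain \<rho> t where y: "y = p + of_real \<rho> * cis t" "0 < \<rho>" "\<bar>t - 0\<bar> < pi * \<alpha> / 2"
      unfolding wedge_def by blast
    have "cos (pi * \<alpha> / 2) < cos \<bar>t\<bar>"
      using y(3) d by (intro cos_monotone_0_pi) auto
    then show "cos (pi * \<alpha> / 2) * norm (y - p) < Re (y - p)"
      using y(2) by (simp add: y(1) norm_mult mult.commute)
  next
    assume *: "cos (pi * \<alpha> / 2) * norm (y - p) < Re (y - p)"
    define t where "t = Arg (y - p)"
    have y: "y - p = of_real (norm (y - p)) * cis t"
      using rcis_cmod_Arg[of "y - p"] by (simp add: rcis_def t_def)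
    have "y - p \<noteq> 0" using * by auto
    then have pos: "0 < norm (y - p)" by simp
    have "Re (y - p) = norm (y - p) * cos t"
      using arg_cong[OF y, of Re] by simp
    then have "cos (pi * \<alpha> / 2) < cos \<bar>t\<bar>"
      using * pos by (simp add: mult.commute)
    moreover have "cos \<bar>t\<bar> \<le> cos (pi * \<alpha> / 2)" if "pi * \<alpha> / 2 \<le> \<bar>t\<bar>"
      using that d mpi_less_Arg[of "y - p"] Arg_le_pi[of "y - p"]
      by (intro cos_monotone_0_pi_le) (auto simp: t_def)
    ultimately have "\<bar>t - 0\<bar> < pi * \<alpha> / 2" by force
    moreover have "y = p + of_real (norm (y - p)) * cis t" using y by (simp add: algebra_simps)
    ultimately show "y \<in> wedge p 0 (pi * \<alpha>)" unfolding wedge_def using pos by blast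
  }
qed

text \<open>For \<open>1 \<le> \<alpha>\<close> the cosine is nonpositive, so the complement is a
  sublevel set of the convex function
  \<open>Re (y - p) - cos (pi * \<alpha> / 2) * norm (y - p)\<close>.\<close>

lemma convex_compl_wedge:
  assumes "1 \<le> \<alpha>" "\<alpha> \<le> 2"
  shows "convex (- wedge p 0 (pi * \<alpha>))"
proof (rule convexI)
  fix x y :: complex and u v :: real
  assume xy: "x \<in> - wedge p 0 (pi * \<alpha>)" "y \<in> - wedge p 0 (pi * \<alpha>)" and uv: "0 \<le> u" "0 \<le> v" "u + v = 1"
  let ?c = "cos (pi * \<alpha> / 2)"
  have "cos (pi * \<alpha> / 2) \<le> cos (pi / 2)"
    using assms by (intro cos_monotone_0_pi_le) auto
  then have c: "?c \<le> 0" by simp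
  have x: "Re (x - p) \<le> ?c * norm (x - p)" and y: "Re (y - p) \<le> ?c * norm (y - p)"
    using xy mem_wedge_iff[OF assms] by auto
  have eq: "u *\<^sub>R x + v *\<^sub>R y - p = u *\<^sub>R (x - p) + v *\<^sub>R (y - p)"
    using scaleR_left.add[of u v p] uv(3) by (simp add: algebra_simps)
  have "norm (u *\<^sub>R x + v *\<^sub>R y - p) \<le> u * norm (x - p) + v * norm (y - p)"
    unfolding eq using uv by (intro norm_triangle_le) simp
  then have "?c * (u * norm (x - p) + v * norm (y - p)) \<le> ?c * norm (u *\<^sub>R x + v *\<^sub>R y - p)"
    using c by (rule mult_left_mono_neg)
  moreover have "Re (u *\<^sub>R x + v *\<^sub>R y - p) = u * Re (x - p) + v * Re (y - p)"
    unfolding eq by simp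
  moreover have "u * Re (x - p) \<le> u * (?c * norm (x - p))" "v * Re (y - p) \<le> v * (?c * norm (y - p))"
    using x y uv by (auto intro!: mult_left_mono)
  ultimately have "Re (u *\<^sub>R x + v *\<^sub>R y - p) \<le> ?c * norm (u *\<^sub>R x + v *\<^sub>R y - p)"
    by (simp add: algebra_simps)
  then show "u *\<^sub>R x + v *\<^sub>R y \<in> - wedge p 0 (pi * \<alpha>)"
    unfolding Compl_iff mem_wedge_iff[OF assms] by simp
qed

text \<open>A narrower wedge around this one could be recentred at \<open>p\<close>, as the
  complement is convex. For two wedges with the same vertex it remains to find a direction in the
  wide one that the narrow one misses.\<close>

lemma has_opening_angle_wedge:
  assumes "1 \<le> \<alpha>" "\<alpha> \<le> 2" "open (wedge p 0 (pi * \<alpha>))"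
  shows "has_opening_angle (wedge p 0 (pi * \<alpha>)) (pi * \<alpha>)"
  unfolding has_opening_angle_def
proof (intro conjI allI impI notI)
  show "\<exists>q \<theta>. wedge p 0 (pi * \<alpha>) \<subseteq> wedge q \<theta> (pi * \<alpha>)" by blast
  fix \<gamma> assume \<gamma>: "\<gamma> < pi * \<alpha>" and "\<exists>q \<theta>. wedge p 0 (pi * \<alpha>) \<subseteq> wedge q \<theta> \<gamma>"
  then obtain q \<theta> where "wedge p 0 (pi * \<alpha>) \<subseteq> wedge q \<theta> \<gamma>" by blast
  moreover have le: "pi * \<alpha> \<le> 2 * pi" using assms(2) by simp
  then have \<gamma>2: "\<gamma> \<le> 2 * pi" using \<gamma> by linarith
  ultimately have "wedge p 0 (pi * \<alpha>) \<subseteq> wedge p \<theta> \<gamma>"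
    using subset_wedge_recenter[OF assms(3) convex_compl_wedge[OF assms(1,2)] _ _ vertex_notin_wedge]
    by blast
  define s where "s = Arg (cis \<theta>)"
  have "cis s = cis \<theta>" using cis_Arg[of "cis \<theta>"] by (simp add: s_def sgn_eq)
  from wedge_cong[OF this, of p \<gamma>]
  have sub: "wedge p 0 (pi * \<alpha>) \<subseteq> wedge p s \<gamma>"
    using \<open>wedge p 0 (pi * \<alpha>) \<subseteq> wedge p \<theta> \<gamma>\<close> by (rule subset_trans[rotated])
  have s: "- pi < s" "s \<le> pi" unfolding s_def by (auto intro: mpi_less_Arg Arg_le_pi)
  have in0: "p + of_real 1 * cis t \<in> wedge p 0 (pi * \<alpha>)" if "\<bar>t\<bar> < pi * \<alpha> / 2" for t
  proof -
    have "\<bar>t - 0\<bar> < pi * \<alpha> / 2" using that by simp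
    then show ?thesis unfolding wedge_def using zero_less_one by blast
  qed
  have "0 < pi * \<alpha> / 2" using assms(1) by simp
  then have "p + of_real 1 * cis 0 \<in> wedge p s \<gamma>" using in0[of 0] sub by auto
  then obtain u where "\<bar>u - s\<bar> < \<gamma> / 2" unfolding wedge_def by blast
  then have pos: "0 < \<gamma>" by linarith
  \<comment> \<open>For \<open>0 \<le> s\<close> the direction \<open>- \<gamma> / 2\<close> is at
    angular distance \<open>s + \<gamma> / 2\<close> from the axis \<open>s\<close>; if this exceeds
    \<open>pi\<close>, the opposite direction \<open>s - pi\<close> is taken. Either choice stays
    within \<open>\<gamma> / 2\<close> of 0. Negative \<open>s\<close> is symmetric.\<close>
  define t where "t = (if 0 \<le> s then max (- \<gamma> / 2) (s - pi) else min (\<gamma> / 2) (s + pi))"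
  have "\<bar>t\<bar> < pi * \<alpha> / 2" "\<bar>t - s\<bar> \<le> pi" "\<gamma> / 2 \<le> \<bar>t - s\<bar>"
    using s pos \<gamma> \<gamma>2 unfolding t_def by (auto simp: max_def min_def abs_if)
  then have "p + of_real 1 * cis t \<in> wedge p s \<gamma>" "p + of_real 1 * cis t \<notin> wedge p s \<gamma>"
    using in0 sub notin_wedge_ray[of \<gamma> t s 1 p] \<gamma>2 by auto
  then show False by simp
qed

text \<open>The divisor \<open>2 * \<alpha>\<close> is the derivative of
  \<open>wedge_map \<alpha> 1\<close> at 0; it puts the vertex of the image at
  \<open>- 1 / (2 * \<alpha>)\<close>.\<close>

definition extremal_map :: "real \<Rightarrow> complex \<Rightarrow> complex" where
  "extremal_map \<alpha> z = (wedge_map \<alpha> 1 z - 1) / of_real (2 * \<alpha>)"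

text \<open>The quotient lies in the right half-plane, so the difference of logarithms is its
  principal logarithm. Estimating the two logarithms separately would only give
  \<open>pi\<close>.\<close>

lemma cayley_log:
  fixes z :: complex
  assumes "norm z < 1"
  shows "exp (Ln (1 + z) - Ln (1 - z)) = (1 + z) / (1 - z)" "\<bar>Im (Ln (1 + z) - Ln (1 - z))\<bar> < pi / 2"
proof -
  have pos: "0 < Re (1 + z)" "0 < Re (1 - z)"
    using Re_one_plus_pos[of 1 z] Re_one_plus_pos[of "-1" z] assms by auto
  then have nz: "1 + z \<noteq> 0" "1 - z \<noteq> 0"
    by (metis less_irrefl zero_complex.sel(1))+
  show e: "exp (Ln (1 + z) - Ln (1 - z)) = (1 + z) / (1 - z)"
    using nz by (simp add: exp_diff)
  have "Re ((1 + z) / (1 - z)) = (1 - (norm z)\<^sup>2) / (norm (1 - z))\<^sup>2"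
    unfolding Re_divide cmod_power2 by (simp add: power2_eq_square algebra_simps)
  also have "\<dots> > 0" using assms nz by (auto intro!: divide_pos_pos simp: power_less_one_iff)
  finally have Re: "0 < Re ((1 + z) / (1 - z))" .
  then have "\<bar>Im (Ln ((1 + z) / (1 - z)))\<bar> < pi / 2"
    using nz Re_Ln_pos_lt by auto
  moreover have "\<bar>Im (Ln (1 + z))\<bar> < pi / 2" "\<bar>Im (Ln (1 - z))\<bar> < pi / 2"
    using pos nz Re_Ln_pos_lt by blast+
  ultimately have "Ln (1 + z) - Ln (1 - z) = Ln ((1 + z) / (1 - z))"
    using exp_complex_eqI[of "Ln (1 + z) - Ln (1 - z)" "Ln ((1 + z) / (1 - z))"] e nz by simp
  then show "\<bar>Im (Ln (1 + z) - Ln (1 - z))\<bar> < pi / 2"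
    using \<open>\<bar>Im (Ln ((1 + z) / (1 - z)))\<bar> < pi / 2\<close> by simp
qed

lemma wedge_map_polar:
  "wedge_map \<alpha> 1 z = of_real (exp (\<alpha> * Re (Ln (1 + z) - Ln (1 - z)))) * cis (\<alpha> * Im (Ln (1 + z) - Ln (1 - z)))"
proof -
  have "wedge_map \<alpha> 1 z = exp (of_real \<alpha> * (Ln (1 + z) - Ln (1 - z)))"
    by (simp add: wedge_map_def)
  also have "\<dots> = of_real (exp (Re (of_real \<alpha> * (Ln (1 + z) - Ln (1 - z))))) * cis (Im (of_real \<alpha> * (Ln (1 + z) - Ln (1 - z))))"
    by (rule exp_eq_polar)
  finally show ?thesis by simp
qed

text \<open>The difference of logarithms maps the disc onto a strip of width \<open>pi\<close>;
  scaling by \<open>\<alpha>\<close> and exponentiating yield the wedge.\<close>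

lemma extremal_map_image:
  assumes "1 \<le> \<alpha>" "\<alpha> \<le> 2"
  shows "extremal_map \<alpha> ` unit_disc = wedge (- 1 / of_real (2 * \<alpha>)) 0 (pi * \<alpha>)"
proof (intro equalityI subsetI)
  fix y assume "y \<in> extremal_map \<alpha> ` unit_disc"
  then obtain z where z: "norm z < 1" "y = extremal_map \<alpha> z" by auto
  let ?L = "Ln (1 + z) - Ln (1 - z)"
  have "y = - 1 / of_real (2 * \<alpha>) + of_real (exp (\<alpha> * Re ?L) / (2 * \<alpha>)) * cis (\<alpha> * Im ?L)"
    unfolding z(2) extremal_map_def wedge_map_polar by (simp add: diff_divide_distrib)
  moreover have "\<bar>\<alpha> * l - 0\<bar> < pi * \<alpha> / 2" if "\<bar>l\<bar> < pi / 2" for l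
    using that assms(1) by (simp add: abs_mult field_simps)
  note this[OF cayley_log(2)[OF z(1)]]
  moreover have "0 < exp (\<alpha> * Re ?L) / (2 * \<alpha>)" using assms(1) by simp
  ultimately show "y \<in> wedge (- 1 / of_real (2 * \<alpha>)) 0 (pi * \<alpha>)"
    unfolding wedge_def by blast
next
  fix y assume "y \<in> wedge (- 1 / of_real (2 * \<alpha>)) 0 (pi * \<alpha>)"
  then obtain \<rho> t where y: "y = - 1 / of_real (2 * \<alpha>) + of_real \<rho> * cis t" "0 < \<rho>" "\<bar>t - 0\<bar> < pi * \<alpha> / 2"
    unfolding wedge_def by blast
  \<comment> \<open>\<open>l\<close> is the point of the strip belonging to \<open>y\<close>,
    \<open>u\<close> the one of the right half-plane, and \<open>z\<close> its inverse Cayley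
    image.\<close>
  define l where "l = Complex (ln (2 * \<alpha> * \<rho>) / \<alpha>) (t / \<alpha>)"
  define u where "u = exp l"
  define z where "z = (u - 1) / (u + 1)"
  have t: "\<bar>t / \<alpha>\<bar> < pi / 2" using y(3) assms(1) by (simp add: field_simps)
  then have "0 < cos (t / \<alpha>)" by (intro cos_gt_zero_pi) linarith+
  then have Reu: "0 < Re u" by (simp add: u_def Re_exp l_def)
  then have u1: "u + 1 \<noteq> 0" by (auto simp: complex_eq_iff)
  have "(norm (u - 1))\<^sup>2 < (norm (u + 1))\<^sup>2"
    unfolding cmod_power2 using Reu by (simp add: power2_eq_square algebra_simps)
  then have "norm (u - 1) < norm (u + 1)" by (rule power2_less_imp_less) simp
  then have z1: "norm z < 1" using u1 by (simp add: z_def norm_divide)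
  have "(1 + z) / (1 - z) = u"
    unfolding z_def using u1 by (simp add: divide_simps)
  then have "exp (Ln (1 + z) - Ln (1 - z)) = exp l" using cayley_log(1)[OF z1] by (simp add: u_def)
  moreover have "\<bar>Im (Ln (1 + z) - Ln (1 - z)) - Im l\<bar> < 2 * pi"
    using cayley_log(2)[OF z1] t unfolding l_def complex.sel by linarith
  ultimately have L: "Ln (1 + z) - Ln (1 - z) = l" using exp_complex_eqI by blast
  have "extremal_map \<alpha> z = y"
    unfolding extremal_map_def wedge_map_polar L using y(2) assms(1)
    by (simp add: l_def y(1) diff_divide_distrib)
  then show "y \<in> extremal_map \<alpha> ` unit_disc" using z1 by force
qed

lemma extremal_map_deriv:
  assumes "1 \<le> \<alpha>" "norm z < 1"
  shows "(extremal_map \<alpha> has_field_derivative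
     exp (of_real (\<alpha> - 1) * Ln (1 + z) - of_real (\<alpha> + 1) * Ln (1 - z))) (at z)"
proof -
  have "(extremal_map \<alpha> has_field_derivative (of_real \<alpha> * (1 + 1) *
      exp (of_real (\<alpha> - 1) * Ln (1 + 1 * z) - of_real (\<alpha> + 1) * Ln (1 - z)) - 0) / of_real (2 * \<alpha>)) (at z)"
    unfolding extremal_map_def
    using assms by (intro DERIV_cdivide DERIV_diff deriv_wedge_map DERIV_const) auto
  then show ?thesis using assms(1) by simp
qed

lemma extremal_map_holomorphic: "1 \<le> \<alpha> \<Longrightarrow> extremal_map \<alpha> holomorphic_on unit_disc"
  unfolding holomorphic_on_open[OF open_ball] mem_ball_0 Ball_def using extremal_map_deriv by blast

text \<open>The scaled logarithms lie in an open strip of width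
  \<open>pi * \<alpha> \<le> 2 * pi\<close>, where \<open>exp\<close> is injective.\<close>

lemma extremal_map_inj:
  assumes "1 \<le> \<alpha>" "\<alpha> \<le> 2"
  shows "inj_on (extremal_map \<alpha>) unit_disc"
proof (rule inj_onI)
  fix z w assume "z \<in> unit_disc" "w \<in> unit_disc" and eq: "extremal_map \<alpha> z = extremal_map \<alpha> w"
  then have z: "norm z < 1" and w: "norm w < 1" by auto
  let ?L = "\<lambda>z. Ln (1 + z) - Ln (1 - z)"
  have "exp (of_real \<alpha> * ?L z) = exp (of_real \<alpha> * ?L w)"
    using eq assms(1) by (simp add: extremal_map_def wedge_map_def)
  moreover have "\<bar>Im (of_real \<alpha> * ?L z) - Im (of_real \<alpha> * ?L w)\<bar> < 2 * pi"
  proof -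
    have "\<bar>Im (of_real \<alpha> * ?L z) - Im (of_real \<alpha> * ?L w)\<bar> = \<alpha> * \<bar>Im (?L z) - Im (?L w)\<bar>"
      using assms(1) by (simp add: abs_mult flip: right_diff_distrib)
    also have "\<dots> \<le> 2 * \<bar>Im (?L z) - Im (?L w)\<bar>"
      using assms(2) by (intro mult_right_mono) auto
    also have "\<dots> \<le> 2 * (\<bar>Im (?L z)\<bar> + \<bar>Im (?L w)\<bar>)"
      by (intro mult_left_mono abs_triangle_ineq4) simp
    also have "\<dots> < 2 * (pi / 2 + pi / 2)"
      using cayley_log(2)[OF z] cayley_log(2)[OF w] by (intro mult_strict_left_mono add_strict_mono) simp_all
    also have "\<dots> = 2 * pi" by simp
    finally show ?thesis .
  qed
  ultimately have "of_real \<alpha> * ?L z = of_real \<alpha> * ?L w"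
    using exp_complex_eqI by blast
  then have "?L z = ?L w" using assms(1) by simp
  then have "(1 + z) / (1 - z) = (1 + w) / (1 - w)"
    using cayley_log(1)[OF z] cayley_log(1)[OF w] by simp
  moreover have "1 - z \<noteq> 0" "1 - w \<noteq> 0" using z w by auto
  ultimately show "z = w" by (simp add: frac_eq_eq algebra_simps)
qed

text \<open>For \<open>q = (1 + z) / (1 - z)\<close> the wedge map has modulus
  \<open>norm q powr \<alpha>\<close>, at least \<open>norm q\<close> once \<open>norm q\<close> is
  at least 1, and \<open>q\<close> tends to infinity at 1.\<close>

lemma extremal_map_at_one:
  assumes "1 \<le> \<alpha>"
  shows "filterlim (extremal_map \<alpha>) at_infinity (at 1 within unit_disc)"
proof -
  let ?F = "at (1::complex) within unit_disc"
  have bound: "(norm ((1 + z) / (1 - z)) - 1) / (2 * \<alpha>) \<le> norm (extremal_map \<alpha> z)" if "z \<in> unit_disc" for z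
  proof -
    let ?L = "Ln (1 + z) - Ln (1 - z)"
    have n: "norm ((1 + z) / (1 - z)) = exp (Re ?L)"
      using cayley_log(1)[of z] that norm_exp_eq_Re[of ?L] by simp
    have "exp (Re ?L) - 1 \<le> norm (wedge_map \<alpha> 1 z - 1)"
    proof (cases "0 \<le> Re ?L")
      case True
      then have "Re ?L \<le> \<alpha> * Re ?L" using assms mult_right_mono[of 1 \<alpha> "Re ?L"] by simp
      then have "exp (Re ?L) \<le> norm (wedge_map \<alpha> 1 z)"
        unfolding wedge_map_polar by (simp add: norm_mult)
      then show ?thesis using norm_triangle_ineq2[of "wedge_map \<alpha> 1 z" 1] by simp
    next
      case False
      then have "exp (Re ?L) - 1 \<le> 0" by simp
      then show ?thesis using norm_ge_zero order_trans by blast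
    qed
    then show ?thesis
      unfolding n unfolding extremal_map_def norm_divide using assms by (simp add: divide_right_mono)
  qed
  have "filterlim (\<lambda>z. (1 + z) / (1 - z)) at_infinity ?F"
  proof (rule filterlim_divide_at_infinity)
    show "((\<lambda>z. 1 + z) \<longlongrightarrow> 1 + 1) ?F" by (intro tendsto_intros)
    have "((\<lambda>z::complex. 1 - z) \<longlongrightarrow> 1 - 1) ?F" by (intro tendsto_intros)
    then show "filterlim (\<lambda>z. 1 - z) (at 0) ?F"
      by (auto simp: filterlim_at eventually_at_filter)
  qed simp
  then have "filterlim (\<lambda>z. norm ((1 + z) / (1 - z))) at_top ?F"
    by (rule filterlim_at_infinity_imp_norm_at_top)
  then have "filterlim (\<lambda>z. 1 / (2 * \<alpha>) * (- 1 + norm ((1 + z) / (1 - z)))) at_top ?F"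
    using assms by (intro filterlim_tendsto_pos_mult_at_top[OF tendsto_const]
      filterlim_tendsto_add_at_top[OF tendsto_const]) auto
  then have "filterlim (\<lambda>z. norm (extremal_map \<alpha> z)) at_top ?F"
  proof (rule filterlim_at_top_mono)
    show "\<forall>\<^sub>F z in ?F. 1 / (2 * \<alpha>) * (- 1 + norm ((1 + z) / (1 - z))) \<le> norm (extremal_map \<alpha> z)"
      using bound by (auto simp: eventually_at_filter)
  qed
  then show ?thesis by (rule filterlim_norm_at_top_imp_at_infinity)
qed

lemma extremal_map_concave:
  assumes "1 \<le> \<alpha>" "\<alpha> \<le> 2"
  shows "extremal_map \<alpha> \<in> concave_class \<alpha>"
proof -
  have "open (extremal_map \<alpha> ` unit_disc)"
    using assms by (intro open_mapping_thm3 extremal_map_holomorphic extremal_map_inj) auto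
  then have "has_opening_angle (extremal_map \<alpha> ` unit_disc) (pi * \<alpha>)"
    unfolding extremal_map_image[OF assms] by (rule has_opening_angle_wedge[OF assms])
  moreover have "deriv (extremal_map \<alpha>) 0 = 1"
    using DERIV_imp_deriv[OF extremal_map_deriv[OF assms(1), of 0]] by simp
  moreover have "extremal_map \<alpha> 0 = 0" by (simp add: extremal_map_def wedge_map_def)
  moreover have "convex (- (extremal_map \<alpha> ` unit_disc))"
    unfolding extremal_map_image[OF assms] by (rule convex_compl_wedge[OF assms])
  ultimately show ?thesis
    using assms extremal_map_holomorphic extremal_map_inj extremal_map_at_one
    by (auto simp: concave_class_def normalized_class_def)
qed

lemma extremal_map_infdist:
  assumes "1 \<le> \<alpha>" "\<alpha> \<le> 2"
  shows "infdist 0 (frontier (extremal_map \<alpha> ` unit_disc)) \<le> 1 / (2 * \<alpha>)"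
proof -
  let ?p = "- 1 / of_real (2 * \<alpha>) :: complex"
  let ?W = "wedge ?p 0 (pi * \<alpha>)"
  \<comment> \<open>The vertex is approached along the axis.\<close>
  have "?p \<in> closure ?W"
    unfolding closure_approachable
  proof (intro allI impI)
    fix e :: real assume "0 < e"
    moreover have "\<bar>0 - 0\<bar> < pi * \<alpha> / 2" using assms(1) by simp
    ultimately have "?p + of_real (e / 2) * cis 0 \<in> ?W"
      unfolding wedge_def using half_gt_zero by blast
    moreover have "dist (?p + of_real (e / 2) * cis 0) ?p < e" using \<open>0 < e\<close> by (simp add: dist_norm)
    ultimately show "\<exists>y\<in>?W. dist y ?p < e" by blast
  qed
  then have "?p \<in> frontier ?W"
    using vertex_notin_wedge[of ?p] interior_subset[of ?W] by (auto simp: frontier_def)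
  then have "infdist 0 (frontier ?W) \<le> dist 0 ?p" by (rule infdist_le)
  then show ?thesis
    unfolding extremal_map_image[OF assms] using assms(1) by (simp add: norm_divide)
qed

lemma extremal_map_of_real:
  assumes "0 \<le> r" "r < 1"
  shows "extremal_map \<alpha> (of_real r) = of_real ((((1 + r) / (1 - r)) powr \<alpha> - 1) / (2 * \<alpha>))"
proof -
  have "Ln (1 + of_real r) - Ln (1 - of_real r) = of_real (ln (1 + r) - ln (1 - r))"
    using assms Ln_of_real[of "1 + r"] Ln_of_real[of "1 - r"] by simp
  moreover have "ln (1 + r) - ln (1 - r) = ln ((1 + r) / (1 - r))"
    using assms by (simp add: ln_div)
  ultimately have "wedge_map \<alpha> 1 (of_real r) = of_real (exp (\<alpha> * ln ((1 + r) / (1 - r))))"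
    by (simp add: wedge_map_def exp_of_real[symmetric])
  then show ?thesis using assms by (simp add: extremal_map_def powr_def)
qed

text \<open>The majorant series at \<open>r\<close> dominates the modulus of the value at the real
  point \<open>r\<close>, so the signs of the coefficients need not be known.\<close>

lemma extremal_sum:
  assumes "1 \<le> \<alpha>" "0 \<le> r" "r < 1" "0 \<le> k"
    and a: "\<And>z. z \<in> unit_disc \<Longrightarrow> (\<lambda>n. a n * z ^ n) sums extremal_map \<alpha> z"
  shows "(1 + k) * ((((1 + r) / (1 - r)) powr \<alpha> - 1) / (2 * \<alpha>))
     \<le> (\<Sum>n. (cmod (a (Suc n)) + cmod (of_real k * a (Suc n))) * r ^ Suc n)"
proof -
  have a0: "a 0 = 0"
    using a[of 0] by (simp add: extremal_map_def wedge_map_def powser_sums_zero_iff)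
  \<comment> \<open>Convergence at a point \<open>x\<close> beyond \<open>r\<close> gives absolute
    convergence at \<open>r\<close>.\<close>
  obtain x where x: "r < x" "x < 1" using dense[OF assms(3)] by blast
  then have "summable (\<lambda>n. norm (a n * of_real r ^ n))"
    using a[of "of_real x"] assms(2)
    by (intro powser_insidea[of _ "of_real x"]) (auto simp: sums_iff)
  then have S: "summable (\<lambda>n. norm (a (Suc n) * of_real r ^ Suc n))"
    by (subst summable_Suc_iff)
  have "(\<lambda>n. a n * of_real r ^ n) sums extremal_map \<alpha> (of_real r)"
    using a assms(2,3) by simp
  then have "(\<lambda>n. a (Suc n) * of_real r ^ Suc n) sums extremal_map \<alpha> (of_real r)"
    by (subst sums_Suc_iff) (simp add: a0)
  then have "norm (extremal_map \<alpha> (of_real r)) \<le> (\<Sum>n. norm (a (Suc n) * of_real r ^ Suc n))"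
    using summable_norm[OF S] by (simp add: sums_iff)
  moreover have "(((1 + r) / (1 - r)) powr \<alpha> - 1) / (2 * \<alpha>) \<le> norm (extremal_map \<alpha> (of_real r))"
    unfolding extremal_map_of_real[OF assms(2,3)] norm_of_real by (rule abs_ge_self)
  ultimately have "(1 + k) * ((((1 + r) / (1 - r)) powr \<alpha> - 1) / (2 * \<alpha>))
      \<le> (1 + k) * (\<Sum>n. norm (a (Suc n) * of_real r ^ Suc n))"
    using assms(4) by (intro mult_left_mono) auto
  also have "\<dots> = (\<Sum>n. (1 + k) * norm (a (Suc n) * of_real r ^ Suc n))"
    by (rule suminf_mult[OF S, symmetric])
  also have "(\<lambda>n. (1 + k) * norm (a (Suc n) * of_real r ^ Suc n))
      = (\<lambda>n. (cmod (a (Suc n)) + cmod (of_real k * a (Suc n))) * r ^ Suc n)"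
    using assms(2,4) by (auto simp: norm_mult norm_power algebra_simps)
  finally show ?thesis .
qed

section \<open>The Bohr radius\<close>

lemma cayley_powr_strict_mono:
  fixes r s \<alpha> :: real
  assumes "0 < \<alpha>" "0 \<le> r" "r < s" "s < 1"
  shows "((1 + r) / (1 - r)) powr \<alpha> < ((1 + s) / (1 - s)) powr \<alpha>"
  using assms by (intro powr_less_mono2 frac_less) auto

lemma radius_equation_iff:
  assumes "1 \<le> K"
  shows "radius_equation K \<alpha> r \<longleftrightarrow> ((1 + r) / (1 - r)) powr \<alpha> = 1 + (K + 1) / (2 * K)"
  using assms by (auto simp: radius_equation_def field_simps)

lemma radius_equation_unique:
  assumes "1 \<le> K" "1 \<le> \<alpha>" "radius_equation K \<alpha> r" "radius_equation K \<alpha> s" "0 \<le> r" "r < 1" "0 \<le> s" "s < 1"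
  shows "r = s"
  using assms cayley_powr_strict_mono[of \<alpha> r s] cayley_powr_strict_mono[of \<alpha> s r]
  unfolding radius_equation_iff[OF assms(1)] by linarith

text \<open>At \<open>r = 1/3\<close> the base is 2, so a root in the interval follows from
  \<open>1 < ?y \<le> 2 \<le> 2 powr \<alpha>\<close>. Equality holds only for \<open>K = 1\<close>
  and \<open>\<alpha> = 1\<close>, where the root is exactly 1/3.\<close>

lemma radius_exists:
  fixes K \<alpha> :: real
  assumes "1 \<le> K" "1 \<le> \<alpha>"
  obtains r where "0 < r" "r \<le> 1/3" "\<not> (K = 1 \<and> \<alpha> = 1) \<Longrightarrow> r < 1/3" "radius_equation K \<alpha> r"
proof -
  let ?y = "1 + (K + 1) / (2 * K)"
  have y: "1 < ?y" "?y \<le> 2" "1 < K \<Longrightarrow> ?y < 2" using assms(1) by (auto simp: field_simps)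
  have third: "(1 + 1/3) / (1 - 1/3 :: real) = 2" by simp
  have p2: "2 \<le> 2 powr \<alpha>" "1 < \<alpha> \<Longrightarrow> 2 < 2 powr \<alpha>"
    using powr_mono[of 1 \<alpha> 2] powr_less_mono[of 1 \<alpha> 2] assms(2) by auto
  have "\<exists>r\<ge>0. r \<le> 1/3 \<and> ((1 + r) / (1 - r)) powr \<alpha> = ?y"
  proof (rule IVT')
    show "((1 + 0) / (1 - 0)) powr \<alpha> \<le> ?y" using y by simp
    show "?y \<le> ((1 + 1/3) / (1 - 1/3)) powr \<alpha>" unfolding third using y p2 by linarith
    show "continuous_on {0..1/3} (\<lambda>r. ((1 + r) / (1 - r)) powr \<alpha>)"
      by (intro continuous_intros) auto
  qed simp
  then obtain r where r: "0 \<le> r" "r \<le> 1/3" "((1 + r) / (1 - r)) powr \<alpha> = ?y" by blast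
  have "r \<noteq> 0" using r(3) y(1) by auto
  moreover have "r \<noteq> 1/3" if "\<not> (K = 1 \<and> \<alpha> = 1)"
  proof
    assume "r = 1/3"
    with r(3) have "2 powr \<alpha> = ?y" by (simp only: third)
    then show False using that y p2 assms by linarith
  qed
  ultimately show thesis
    using that[of r] r radius_equation_iff[OF assms(1), of \<alpha> r] by force
qed

text \<open>An image inside a wedge omits the vertex, so it is not the plane and has boundary
  points; being open, it contains none of them.\<close>

lemma concave_class_frontier:
  assumes "\<phi> \<in> concave_class \<alpha>"
  shows "frontier (\<phi> ` unit_disc) \<noteq> {}" "\<And>c. c \<in> frontier (\<phi> ` unit_disc) \<Longrightarrow> c \<notin> \<phi> ` unit_disc"
proof -
  have \<phi>: "\<phi> holomorphic_on unit_disc" "inj_on \<phi> unit_disc"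
    and "\<exists>\<beta> p \<theta>. \<phi> ` unit_disc \<subseteq> wedge p \<theta> \<beta>"
    using assms by (auto simp: concave_class_def normalized_class_def has_opening_angle_def)
  then have "\<phi> ` unit_disc \<noteq> UNIV" using vertex_notin_wedge by blast
  then show "frontier (\<phi> ` unit_disc) \<noteq> {}" by (simp add: frontier_eq_empty)
  have "open (\<phi> ` unit_disc)" by (rule open_mapping_thm3[OF \<phi>(1) open_ball \<phi>(2)])
  then show "c \<notin> \<phi> ` unit_disc" if "c \<in> frontier (\<phi> ` unit_disc)" for c
    using that by (auto simp: frontier_def interior_open)
qed

theorem theorem5p1:
  fixes K \<alpha> :: real
  assumes "K \<ge> 1" and "1 \<le> \<alpha>" and "\<alpha> \<le> 2"
  shows "\<exists>r0::real.
    0 < r0 \<and> r0 \<le> 1/3 \<and> (\<not> (K = 1 \<and> \<alpha> = 1) \<longrightarrow> r0 < 1/3) \<and>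
    radius_equation K \<alpha> r0 \<and>
    (\<forall>r. 0 \<le> r \<and> r < 1 \<and> radius_equation K \<alpha> r \<longrightarrow> r = r0) \<and>
    (\<forall>f h g \<phi> (a :: nat \<Rightarrow> complex) (b :: nat \<Rightarrow> complex).
       quasiconformal_harmonic K f h g \<and>
       (\<forall>z\<in>unit_disc. (\<lambda>n. a n * z ^ n) sums h z) \<and>
       (\<forall>z\<in>unit_disc. (\<lambda>n. b (Suc n) * z ^ Suc n) sums g z) \<and>
       \<phi> \<in> concave_class \<alpha> \<and> subordinate h \<phi> \<longrightarrow>
       (\<forall>r. 0 \<le> r \<and> r \<le> r0 \<longrightarrow>
          summable (\<lambda>n. (cmod (a (Suc n)) + cmod (b (Suc n))) * r ^ Suc n) \<and>
          (\<Sum>n. (cmod (a (Suc n)) + cmod (b (Suc n))) * r ^ Suc n)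
            \<le> infdist (\<phi> 0) (frontier (\<phi> ` unit_disc)))) \<and>
    (\<forall>R. r0 < R \<and> R < 1 \<longrightarrow>
       (\<exists>f h g \<phi> (a :: nat \<Rightarrow> complex) (b :: nat \<Rightarrow> complex).
          quasiconformal_harmonic K f h g \<and>
          (\<forall>z\<in>unit_disc. (\<lambda>n. a n * z ^ n) sums h z) \<and>
          (\<forall>z\<in>unit_disc. (\<lambda>n. b (Suc n) * z ^ Suc n) sums g z) \<and>
          \<phi> \<in> concave_class \<alpha> \<and> subordinate h \<phi> \<and>
          (\<exists>r. 0 \<le> r \<and> r \<le> R \<and>
             (\<Sum>n. (cmod (a (Suc n)) + cmod (b (Suc n))) * r ^ Suc n)
               > infdist (\<phi> 0) (frontier (\<phi> ` unit_disc)))))"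
proof -
  obtain r0 where r0: "0 < r0" "r0 \<le> 1/3" "\<not> (K = 1 \<and> \<alpha> = 1) \<Longrightarrow> r0 < 1/3" "radius_equation K \<alpha> r0"
    using radius_exists[OF assms(1,2)] by blast
  let ?U = "\<lambda>r::real. ((1 + r) / (1 - r)) powr \<alpha>"
  have U0: "?U r0 = 1 + (K + 1) / (2 * K)" using r0(4) radius_equation_iff[OF assms(1)] by blast
  have unique: "r = r0" if "0 \<le> r" "r < 1" "radius_equation K \<alpha> r" for r
    using radius_equation_unique[OF assms(1,2) that(3) r0(4)] that r0 by simp
  have main: "summable (\<lambda>n. (cmod (a (Suc n)) + cmod (b (Suc n))) * r ^ Suc n) \<and>
      (\<Sum>n. (cmod (a (Suc n)) + cmod (b (Suc n))) * r ^ Suc n) \<le> infdist (\<phi> 0) (frontier (\<phi> ` unit_disc))"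
    if qc: "quasiconformal_harmonic K f h g"
      and a: "\<forall>z\<in>unit_disc. (\<lambda>n. a n * z ^ n) sums h z"
      and b: "\<forall>z\<in>unit_disc. (\<lambda>n. b (Suc n) * z ^ Suc n) sums g z"
      and \<phi>: "\<phi> \<in> concave_class \<alpha>" and sub: "subordinate h \<phi>" and r: "0 \<le> r" "r \<le> r0"
    for f h g \<phi> and a b :: "nat \<Rightarrow> complex" and r
  proof -
    let ?t = "\<lambda>n. (cmod (a (Suc n)) + cmod (b (Suc n))) * r ^ Suc n"
    have "?U r \<le> ?U r0"
      using cayley_powr_strict_mono[of \<alpha> r r0] r r0(2) assms(2) by (cases "r = r0") auto
    moreover have "(K + 1) / (2 * K) \<le> 1" using assms(1) by simp
    \<comment> \<open>This is the condition under which \<open>x = 1\<close> is known to be the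
      worst case.\<close>
    ultimately have U: "?U r \<le> 2" unfolding U0 by linarith
    have "2 * K / (K + 1) * (?U r - 1) \<le> 2 * K / (K + 1) * ((K + 1) / (2 * K))"
      using \<open>?U r \<le> ?U r0\<close> assms(1) unfolding U0 by (intro mult_left_mono) auto
    then have U1: "2 * K / (K + 1) * (?U r - 1) \<le> 1" using assms(1) by simp
    \<comment> \<open>Each boundary point is treated separately; since \<open>\<phi> 0 = 0\<close>,
      the infimum of \<open>norm c\<close> is the required distance.\<close>
    have partial: "(\<Sum>n<N. ?t n) \<le> norm c" if "c \<in> frontier (\<phi> ` unit_disc)" for c N
    proof -
      have "(\<Sum>n<N. ?t n) \<le> 2 * K / (K + 1) * (?U r - 1) * norm c"
        using a b r r0(2) U concave_class_frontier(2)[OF \<phi> that]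
        by (intro quasiconformal_partial_sums[OF assms(2,3,1) qc _ _ \<phi> sub]) auto
      also have "\<dots> \<le> 1 * norm c" using U1 by (intro mult_right_mono) auto
      finally show ?thesis by simp
    qed
    obtain c where "c \<in> frontier (\<phi> ` unit_disc)" using concave_class_frontier(1)[OF \<phi>] by blast
    then have S: "summable ?t"
      using partial r by (intro summableI_nonneg_bounded[of _ "norm c"]) auto
    have "(\<Sum>n. ?t n) \<le> norm c" if "c \<in> frontier (\<phi> ` unit_disc)" for c
      by (intro suminf_le_const[OF S] partial that)
    moreover have "\<phi> 0 = 0" using \<phi> by (simp add: concave_class_def normalized_class_def)
    ultimately have "(\<Sum>n. ?t n) \<le> infdist (\<phi> 0) (frontier (\<phi> ` unit_disc))"
      unfolding infdist_notempty[OF concave_class_frontier(1)[OF \<phi>]]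
      by (intro cINF_greatest concave_class_frontier(1)[OF \<phi>]) simp
    with S show ?thesis by blast
  qed
  have sharp: "\<exists>f h g \<phi> (a :: nat \<Rightarrow> complex) (b :: nat \<Rightarrow> complex).
          quasiconformal_harmonic K f h g \<and>
          (\<forall>z\<in>unit_disc. (\<lambda>n. a n * z ^ n) sums h z) \<and>
          (\<forall>z\<in>unit_disc. (\<lambda>n. b (Suc n) * z ^ Suc n) sums g z) \<and>
          \<phi> \<in> concave_class \<alpha> \<and> subordinate h \<phi> \<and>
          (\<exists>r. 0 \<le> r \<and> r \<le> R \<and>
             (\<Sum>n. (cmod (a (Suc n)) + cmod (b (Suc n))) * r ^ Suc n)
               > infdist (\<phi> 0) (frontier (\<phi> ` unit_disc)))"
    if R: "r0 < R" "R < 1" for R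
  proof -
    \<comment> \<open>Sharpness is tested on \<open>h = \<phi>\<close> and \<open>g = k * h\<close>,
      with constant dilatation \<open>k\<close>; the series of \<open>g\<close> is exactly
      \<open>k\<close> times that of \<open>h\<close>.\<close>
    let ?h = "extremal_map \<alpha>"
    define k where "k = (K - 1) / (K + 1)"
    have k: "0 \<le> k" "k < 1" "1 + k = 2 * K / (K + 1)" using assms(1) by (auto simp: k_def field_simps)
    define a where "a n = (deriv ^^ n) ?h 0 / fact n" for n
    have a: "(\<lambda>n. a n * z ^ n) sums ?h z" if "z \<in> unit_disc" for z
      using holomorphic_power_series[OF extremal_map_holomorphic[OF assms(2)] that] by (simp add: a_def)
    have h0: "?h 0 = 0" by (simp add: extremal_map_def wedge_map_def)
    have a0: "a 0 = 0" by (simp add: a_def h0)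
    have b: "(\<lambda>n. of_real k * a (Suc n) * z ^ Suc n) sums (of_real k * ?h z)" if "z \<in> unit_disc" for z
    proof -
      have "(\<lambda>n. a (Suc n) * z ^ Suc n) sums ?h z"
        using a[OF that] by (subst sums_Suc_iff) (simp add: a0)
      from sums_mult[OF this, of "of_real k"] show ?thesis by (simp add: mult.assoc)
    qed
    have dh: "deriv ?h z \<noteq> 0" "?h field_differentiable at z" if "z \<in> unit_disc" for z
      using DERIV_imp_deriv[OF extremal_map_deriv[OF assms(2), of z]] extremal_map_deriv[OF assms(2), of z] that
      by (auto simp: field_differentiable_def)
    have "dilatation ?h (\<lambda>z. of_real k * ?h z) z = of_real k" if "z \<in> unit_disc" for z
      unfolding dilatation_def using dh[OF that] by simp
    then have qc: "quasiconformal_harmonic K (\<lambda>z. ?h z + cnj (of_real k * ?h z)) ?h (\<lambda>z. of_real k * ?h z)"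
      unfolding quasiconformal_harmonic_def sense_preserving_harmonic_def k_def[symmetric]
      using k dh extremal_map_holomorphic[OF assms(2)] by (auto intro!: holomorphic_intros)
    have sub: "subordinate ?h ?h"
      unfolding subordinate_def by (intro exI[of _ "\<lambda>z. z"]) (auto intro!: holomorphic_intros)
    have "infdist (?h 0) (frontier (?h ` unit_disc)) \<le> 1 / (2 * \<alpha>)"
      unfolding h0 by (rule extremal_map_infdist[OF assms(2,3)])
    \<comment> \<open>The right side equals 1 at the root \<open>r0\<close> and increases
      strictly.\<close>
    also have "1 < (1 + k) * (?U R - 1)"
      using cayley_powr_strict_mono[of \<alpha> r0 R] R r0(1) assms(1,2) unfolding U0 k(3) by (auto simp: field_simps)
    then have "1 / (2 * \<alpha>) < (1 + k) * ((?U R - 1) / (2 * \<alpha>))"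
      using assms(2) by (simp add: divide_strict_right_mono)
    also have "\<dots> \<le> (\<Sum>n. (cmod (a (Suc n)) + cmod (of_real k * a (Suc n))) * R ^ Suc n)"
      using R r0(1) by (intro extremal_sum assms k a) auto
    finally have "infdist (?h 0) (frontier (?h ` unit_disc))
        < (\<Sum>n. (cmod (a (Suc n)) + cmod (of_real k * a (Suc n))) * R ^ Suc n)" .
    then have gt: "\<exists>r. 0 \<le> r \<and> r \<le> R \<and>
        (\<Sum>n. (cmod (a (Suc n)) + cmod (of_real k * a (Suc n))) * r ^ Suc n)
          > infdist (?h 0) (frontier (?h ` unit_disc))"
      using R r0(1) by (intro exI[of _ R] conjI) auto
    show ?thesis
      apply (rule exI[of _ "\<lambda>z. ?h z + cnj (of_real k * ?h z)"], rule exI[of _ ?h],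
          rule exI[of _ "\<lambda>z. of_real k * ?h z"], rule exI[of _ ?h], rule exI[of _ a],
          rule exI[of _ "\<lambda>n. of_real k * a n"])
      by (intro conjI qc extremal_map_concave[OF assms(2,3)] sub gt ballI a b)
  qed
  have unique_all: "\<forall>r. 0 \<le> r \<and> r < 1 \<and> radius_equation K \<alpha> r \<longrightarrow> r = r0"
    using unique by blast
  have main_all: "\<forall>f h g \<phi> (a :: nat \<Rightarrow> complex) (b :: nat \<Rightarrow> complex).
       quasiconformal_harmonic K f h g \<and>
       (\<forall>z\<in>unit_disc. (\<lambda>n. a n * z ^ n) sums h z) \<and>
       (\<forall>z\<in>unit_disc. (\<lambda>n. b (Suc n) * z ^ Suc n) sums g z) \<and>
       \<phi> \<in> concave_class \<alpha> \<and> subordinate h \<phi> \<longrightarrow>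
       (\<forall>r. 0 \<le> r \<and> r \<le> r0 \<longrightarrow>
          summable (\<lambda>n. (cmod (a (Suc n)) + cmod (b (Suc n))) * r ^ Suc n) \<and>
          (\<Sum>n. (cmod (a (Suc n)) + cmod (b (Suc n))) * r ^ Suc n)
            \<le> infdist (\<phi> 0) (frontier (\<phi> ` unit_disc)))"
    by (intro allI impI, elim conjE, rule main)
  show ?thesis
    by (rule exI[of _ r0], intro conjI r0(1,2,4) unique_all main_all)
      (use r0(3) in blast, intro allI impI, elim conjE, rule sharp)
qed

end
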